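(* Let $n\ge1$ and $\pi=\pi_1\cdots\pi_n\in S_n$. Let $d$ be a positive integer. Let $E_d(r)$ denote the number of (unlabeled) $d$-ary plane trees with $r$ vertices. The number of decreasing $d$-ary plane trees (on $[n]$) with postorder $\pi$ is \[\sum_{\mathscr H\in\mathcal H_{[d]\cup\{0\}}(\pi)}\left(\prod_{j=1}^n\binom{d}{w_j(\mathscr H)}\right)\left(\prod_{t=0}^{|\mathscr H|}E_d(q_t(\mathscr H))\right).\]
   Context: Notation: $[m]=\{1,\ldots,m\}$; permutations in $S_n$ are written as words $\pi_1\cdots\pi_n$. A descent of $\pi$ is an index $i\in[n-1]$ with $\pi_i>\pi_{i+1}$. Trees. A $d$-ary plane tree is either empty or a root together with a $d$-tuple of (possibly empty) $d$-ary plane trees. A decreasing $d$-ary plane tree on a finite set $X$ of positive integers is a $d$-ary plane tree whose vertices are labeled bijectively by the elements of $X$ so that each nonroot vertex has a smaller label than its parent. The postorder of a tree is the word obtained by recursively reading the subtrees of the root in postorder from left to right and then reading the root (the empty tree contributes the empty word). Valid hook configurations. The diagram of $\pi$ consists of the points $(i,\pi_i)$, $i\in[n]$. A hook $H$ is determined by indices $i<j$ with $\pi_i<\pi_j$: it is the union of the vertical segment from $(i,\pi_i)$ to $(i,\pi_j)$ and the horizontal segment from $(i,\pi_j)$ to $(j,\pi_j)$. Its southwest endpoint is ${}_eH=(i,\pi_i)$ and its northeast endpoint is $H^e=(j,\pi_j)$. A valid hook configuration of $\pi$ is an $m$-tuple $\mathscr H=(H_1,\ldots,H_m)$ ($m\ge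 0$) of hooks in the diagram of $\pi$ such that: (a) if ${}_eH_\ell=(i_\ell,\pi_{i_\ell})$ for each $\ell\in[m]$, then $i_1<i_2<\cdots<i_m$; (b) if $i$ is a descent of $\pi$, then $(i,\pi_i)={}_eH_\ell$ for some $\ell\in[m]$; (c) if $(j,\pi_j)=H_\ell^e$ for some $\ell\in[m]$, then there exist $\ell',\ell''\in[m]$ such that the $x$-coordinate of ${}_eH_{\ell'}$ is a descent of $\pi$, $(j-1,\pi_{j-1})={}_eH_{\ell''}$, and $H_{\ell'}^e=H_{\ell''}^e=(j,\pi_j)$; (d) if $\ell,\ell'\in[m]$, ${}_eH_\ell=(i,\pi_i)$, $H_\ell^e=(j,\pi_j)$, ${}_eH_{\ell'}=(i',\pi_{i'})$, $H_{\ell'}^e=(j',\pi_{j'})$, $\pi_j<\pi_{j'}$, and the real intervals $[i,j]$ and $[i',j']$ have more than one point in common, then $[i,j]\subseteq[i',j']$. The identity permutation has exactly one valid hook configuration, the empty one. Write $\mathcal H(\pi)$ for the set of valid hook configurations of $\pi$, $|\mathscr H|=m$ for the number of hooks, and $NE(\mathscr H)=\{H_1^e,\ldots,H_m^e\}$. For $j\in[n]$, $w_j(\mathscr H)$ is the number of hooks in $\mathscr H$ with northeast endpoint $(j,\pi_j)$. For a set $S$ of nonnegative integers containing $0$, $\mathcal H_S(\pi)=\{\mathscr H\in\mathcal H(\pi): w_j(\mathscr H)\in S\text{ for all }j\in[n]\}$. Coloring. Given $\mathscr H=(H_1,\ldots,H_m)\in\mathcal H(\pi)$, color the points of the diagram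 with colors $c_0,\ldots,c_m$. The hook $H_\ell$ has color $c_\ell$; if ${}_eH_\ell=(i,\pi_i)$ and $H_\ell^e=(j,\pi_j)$, its top part is the segment from $(i+1/2,\pi_j)$ to $(j,\pi_j)$. If $(k,\pi_k)\in NE(\mathscr H)$, give $(k,\pi_k)$ the color $c_r$ where $r$ is the largest index with $H_r^e=(k,\pi_k)$. Otherwise move directly upward from $(k,\pi_k)$ until first hitting the top part of a hook, and give $(k,\pi_k)$ the color of that hook; if several hooks are hit simultaneously, use the one whose southwest endpoint is farthest to the right; if no top part is hit, use $c_0$. Let $q_t(\mathscr H)$ be the number of points $(\ell,\pi_\ell)$ of color $c_t$. *)

theory Defs
  imports Complex_Main "HOL-Combinatorics.Permutations"
begin

section \<open>Plane trees\<close>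

text \<open>Unlabeled plane trees are the trees over \<^typ>\<open>unit\<close>.\<close>

datatype 'a ptree = Empty | Node 'a "'a ptree list"

fun dary :: "nat \<Rightarrow> 'a ptree \<Rightarrow> bool" where
  "dary d Empty \<longleftrightarrow> True"
| "dary d (Node x ts) \<longleftrightarrow> length ts = d \<and> (\<forall>t\<in>set ts. dary d t)"

fun num_vertices :: "'a ptree \<Rightarrow> nat" where
  "num_vertices Empty = 0"
| "num_vertices (Node x ts) = Suc (sum_list (map num_vertices ts))"

fun postorder :: "'a ptree \<Rightarrow> 'a list" where
  "postorder Empty = []"
| "postorder (Node x ts) = concat (map postorder ts) @ [x]"

fun decreasing :: "nat ptree \<Rightarrow> bool" where
  "decreasing Empty \<longleftrightarrow> True"
| "decreasing (Node x ts) \<longleftrightarrow>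
     (\<forall>t\<in>set ts. decreasing t \<and> (\<forall>y us. t = Node y us \<longrightarrow> y < x))"

text \<open>The vertices are labeled bijectively by \<open>X\<close> iff the labels that occur are exactly the
  elements of \<open>X\<close> and there are as many vertices as elements of \<open>X\<close>.\<close>

definition decreasing_dary_trees :: "nat \<Rightarrow> nat set \<Rightarrow> nat ptree set" where
  "decreasing_dary_trees d X =
     {t. dary d t \<and> set_ptree t = X \<and> num_vertices t = card X \<and> decreasing t}"

definition num_dary_trees :: "nat \<Rightarrow> nat \<Rightarrow> nat" where
  "num_dary_trees d r = card {t :: unit ptree. dary d t \<and> num_vertices t = r}"

section \<open>Valid hook configurations\<close>

text \<open>An element \<open>\<pi>\<close> of $S_n$ is a function with \<open>\<pi> permutes {1..n}\<close>.\<close>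

definition word :: "nat \<Rightarrow> (nat \<Rightarrow> nat) \<Rightarrow> nat list" where
  "word n \<pi> = map \<pi> [1..<Suc n]"

definition descents :: "nat \<Rightarrow> (nat \<Rightarrow> nat) \<Rightarrow> nat set" where
  "descents n \<pi> = {i\<in>{1..<n}. \<pi> i > \<pi> (i + 1)}"

text \<open>A hook is represented by the pair \<open>(i, j)\<close> that determines it; \<open>sw\<close> and \<open>ne\<close> are the
  x-coordinates of its southwest endpoint \<open>(i, \<pi> i)\<close> and northeast endpoint \<open>(j, \<pi> j)\<close>.
  Points of the diagram are identified with their x-coordinates.\<close>

type_synonym hook = "nat \<times> nat"

abbreviation sw :: "hook \<Rightarrow> nat" where "sw \<equiv> fst"
abbreviation ne :: "hook \<Rightarrow> nat" where "ne \<equiv> snd"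

definition is_hook :: "nat \<Rightarrow> (nat \<Rightarrow> nat) \<Rightarrow> hook \<Rightarrow> bool" where
  "is_hook n \<pi> h \<longleftrightarrow> sw h \<in> {1..n} \<and> ne h \<in> {1..n} \<and> sw h < ne h \<and> \<pi> (sw h) < \<pi> (ne h)"

definition span :: "hook \<Rightarrow> real set" where
  "span h = {real (sw h)..real (ne h)}"

text \<open>A tuple of hooks is a list; in the mathematical indexing starting from 1,
  its \<open>l\<close>-th hook is \<open>nth_hook \<H> l\<close>.\<close>

definition nth_hook :: "hook list \<Rightarrow> nat \<Rightarrow> hook" where
  "nth_hook \<H> l = \<H> ! (l - 1)"

definition valid_hook_configs :: "nat \<Rightarrow> (nat \<Rightarrow> nat) \<Rightarrow> hook list set" where
  "valid_hook_configs n \<pi> = {\<H>.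
     (\<forall>h\<in>set \<H>. is_hook n \<pi> h) \<and>
     sorted_wrt (<) (map sw \<H>) \<and>
     (\<forall>i\<in>descents n \<pi>. \<exists>h\<in>set \<H>. sw h = i) \<and>
     (\<forall>h\<in>set \<H>. \<exists>h'\<in>set \<H>. \<exists>h''\<in>set \<H>.
        sw h' \<in> descents n \<pi> \<and> sw h'' = ne h - 1 \<and> ne h' = ne h \<and> ne h'' = ne h) \<and>
     (\<forall>h\<in>set \<H>. \<forall>h'\<in>set \<H>.
        \<pi> (ne h) < \<pi> (ne h') \<and> (\<exists>x y. x \<noteq> y \<and> x \<in> span h \<inter> span h' \<and> y \<in> span h \<inter> span h')
        \<longrightarrow> span h \<subseteq> span h')}"

definition ne_count :: "hook list \<Rightarrow> nat \<Rightarrow> nat" where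
  "ne_count \<H> j = card {l\<in>{1..length \<H>}. ne (nth_hook \<H> l) = j}"

definition valid_hook_configs_in :: "nat set \<Rightarrow> nat \<Rightarrow> (nat \<Rightarrow> nat) \<Rightarrow> hook list set" where
  "valid_hook_configs_in S n \<pi> = {\<H>\<in>valid_hook_configs n \<pi>. \<forall>j\<in>{1..n}. ne_count \<H> j \<in> S}"

section \<open>The coloring\<close>

definition top_part :: "(nat \<Rightarrow> nat) \<Rightarrow> hook \<Rightarrow> (real \<times> real) set" where
  "top_part \<pi> h = {real (sw h) + 1/2..real (ne h)} \<times> {real (\<pi> (ne h))}"

text \<open>The heights at which the ray going upward from \<open>(k, \<pi> k)\<close> meets a top part.\<close>

definition hit_heights :: "(nat \<Rightarrow> nat) \<Rightarrow> hook list \<Rightarrow> nat \<Rightarrow> real set" where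
  "hit_heights \<pi> \<H> k = {y. real (\<pi> k) < y \<and> (\<exists>h\<in>set \<H>. (real k, y) \<in> top_part \<pi> h)}"

text \<open>The index \<open>t\<close> of the color $c_t$ of the point \<open>(k, \<pi> k)\<close>.\<close>

definition color :: "(nat \<Rightarrow> nat) \<Rightarrow> hook list \<Rightarrow> nat \<Rightarrow> nat" where
  "color \<pi> \<H> k =
     (if \<exists>h\<in>set \<H>. ne h = k then Max {r\<in>{1..length \<H>}. ne (nth_hook \<H> r) = k}
      else if hit_heights \<pi> \<H> k = {} then 0
      else (ARG_MAX (\<lambda>l. sw (nth_hook \<H> l)) l. l \<in> {1..length \<H>} \<and>
              (real k, Min (hit_heights \<pi> \<H> k)) \<in> top_part \<pi> (nth_hook \<H> l)))"

definition color_count :: "nat \<Rightarrow> (nat \<Rightarrow> nat) \<Rightarrow> hook list \<Rightarrow> nat \<Rightarrow> nat" where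
  "color_count n \<pi> \<H> t = card {l\<in>{1..n}. color \<pi> \<H> l = t}"

end

theory Submission
  imports Defs "HOL-Library.FuncSet"
begin

text \<open>
  Cut a decreasing plane tree along the hooks: let \<open>i\<close> be the descent with the largest top, and
  let \<open>j\<close> be its parent. The children of \<open>j\<close> are the southwest endpoints of the hooks ending at
  \<open>j\<close>. Removing all of \<open>j\<close>'s subtree except the part hanging from its first child, and splicing
  that child into the place of \<open>j\<close>, gives a decreasing tree on an outer set of positions together
  with one tree for each further child; by maximality of \<open>i\<close> the labels after \<open>j\<close> increase, so
  conversely every choice of these trees can be glued back. Valid hook configurations decompose
  in the same way, compatibly with the coloring. Hence both sides of the formula satisfy the same
  recurrence, and they agree on words without descents, where every tree shape carries exactly
  one labeling.

  A decreasing tree without slot choices is itself a kind of hook configuration in which every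
  non-root vertex has a hook to its parent, so one decomposition lemma serves both sides and also
  yields the recursion at the root of a tree.
\<close>

section \<open>Hook configurations on finite sets of positions\<close>

text \<open>A hook configuration need not have a hook ending at the last position, so cutting at the
  root cannot relate it to a tree; the cut must follow a hook that both sides have. At the highest
  descent \<open>i\<close> the endpoint \<open>j\<close> satisfies \<pi> i < \<pi> j, and an
  inversion whose larger entry exceeds \<pi> i would contain a descent with a higher top than
  \<open>i\<close>. So everything before \<open>j\<close> is lower than \<open>j\<close> and
  everything after it is higher. Removing positions then creates one new adjacency, between the
  first child of \<open>j\<close> and the successor of \<open>j\<close>; that successor follows a
  lower entry before and after the removal, so no descent is gained or lost there.

  The coloring respects the cut. In a removed piece, points hit by a hook of the piece keep their
  color, since these hooks stay below \<pi> j; the others go to the hook ending at \<open>j\<close>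
  that starts with the piece. So the \<open>c_0\<close> class of each removed piece becomes the
  class of one hook ending at \<open>j\<close>, and only the binomial at \<open>j\<close>, which
  chooses slots for the children, is left over.\<close>

text \<open>
  A hook with southwest position \<open>i\<close> and northeast position \<open>e\<close> is encoded by the pair \<open>(l, e)\<close>
  where \<open>l\<close> is the successor of \<open>i\<close> in the current set of positions. In this form hooks keep
  their encoding when a block of positions is removed, and a hook covers exactly the positions
  in \<open>{l..e}\<close>. With \<open>full = False\<close> the required hooks are those at descents; with \<open>full = True\<close>
  every position but the last needs a hook, and the hook sets describe decreasing plane trees.
\<close>

definition covers :: "nat set \<Rightarrow> nat \<Rightarrow> nat \<Rightarrow> bool" where
  "covers P p l \<longleftrightarrow> p \<in> P \<and> l \<in> P \<and> p < l \<and> (\<forall>x\<in>P. \<not> (p < x \<and> x < l))"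

definition required :: "bool \<Rightarrow> (nat \<Rightarrow> nat) \<Rightarrow> nat set \<Rightarrow> nat \<Rightarrow> bool" where
  "required full \<pi> P l \<longleftrightarrow> (\<exists>p. covers P p l \<and> (full \<or> \<pi> l < \<pi> p))"

text \<open>The pair \<open>(e, e)\<close> encodes the hook from the predecessor of \<open>e\<close>
  that condition (c) demands. In the last clause \<open>l \<le> e'\<close> and
  \<open>l' \<le> e\<close> say that the two intervals share more than a point, because
  \<open>l\<close> and \<open>l'\<close> are successors of the true left ends.\<close>

definition hook_sets :: "bool \<Rightarrow> (nat \<Rightarrow> nat) \<Rightarrow> nat set \<Rightarrow> (nat \<times> nat) set set" where
  "hook_sets full \<pi> P = {K. K \<subseteq> P \<times> P \<and>
     (\<forall>l e. (l, e) \<in> K \<longrightarrow> l \<le> e \<and> (\<exists>p. covers P p l \<and> \<pi> p < \<pi> e)) \<and>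
     (\<forall>l e e'. (l, e) \<in> K \<longrightarrow> (l, e') \<in> K \<longrightarrow> e = e') \<and>
     (\<forall>l. required full \<pi> P l \<longrightarrow> (\<exists>e. (l, e) \<in> K)) \<and>
     (\<forall>l e. (l, e) \<in> K \<longrightarrow> (e, e) \<in> K \<and> (\<exists>l'. required full \<pi> P l' \<and> (l', e) \<in> K)) \<and>
     (\<forall>l e l' e'. (l, e) \<in> K \<longrightarrow> (l', e') \<in> K \<longrightarrow> \<pi> e < \<pi> e' \<longrightarrow> l \<le> e' \<longrightarrow> l' \<le> e
        \<longrightarrow> l' \<le> l \<and> e \<le> e')}"

text \<open>
  A northeast endpoint is hit by its own hooks, at its own height. This merges the two cases of the
  coloring: the color of \<open>x\<close> is its \<open>first_hit\<close>, and $c_0$ if there is no hit.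
\<close>

definition hit :: "(nat \<Rightarrow> nat) \<Rightarrow> (nat \<times> nat) set \<Rightarrow> nat \<Rightarrow> nat \<times> nat \<Rightarrow> bool" where
  "hit \<pi> K x h \<longleftrightarrow> h \<in> K \<and> fst h \<le> x \<and> x \<le> snd h \<and> \<pi> x \<le> \<pi> (snd h)"

definition first_hit :: "(nat \<Rightarrow> nat) \<Rightarrow> (nat \<times> nat) set \<Rightarrow> nat \<Rightarrow> nat \<times> nat \<Rightarrow> bool" where
  "first_hit \<pi> K x h \<longleftrightarrow> hit \<pi> K x h \<and>
     (\<forall>h'. hit \<pi> K x h' \<longrightarrow> \<pi> (snd h) < \<pi> (snd h') \<or> snd h = snd h' \<and> fst h' \<le> fst h)"

definition weight :: "(nat \<Rightarrow> nat) \<Rightarrow> nat \<Rightarrow> (nat \<Rightarrow> nat) \<Rightarrow> nat set \<Rightarrow> (nat \<times> nat) set \<Rightarrow> nat" where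
  "weight E d \<pi> P K =
     (\<Prod>x\<in>P. d choose card {l. (l, x) \<in> K}) *
     (E (card {x\<in>P. \<forall>h. \<not> hit \<pi> K x h}) * (\<Prod>h\<in>K. E (card {x\<in>P. first_hit \<pi> K x h})))"

text \<open>Two instances matter. On {1..n}, \<open>full = False\<close> with
  \<open>E = num_dary_trees d\<close> gives the right side of the theorem. With
  \<open>full = True\<close> and \<open>E\<close> constantly 1 it counts decreasing trees: the hooks
  fix the parent of every position, and the binomials choose which of the \<open>d\<close> slots
  hold the children.\<close>

definition hook_total :: "bool \<Rightarrow> (nat \<Rightarrow> nat) \<Rightarrow> nat \<Rightarrow> (nat \<Rightarrow> nat) \<Rightarrow> nat set \<Rightarrow> nat" where
  "hook_total full E d \<pi> P = (\<Sum>K\<in>hook_sets full \<pi> P. weight E d \<pi> P K)"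

lemma covers_unique: "covers P p l \<Longrightarrow> covers P p' l \<Longrightarrow> p = p'"
  unfolding covers_def by (meson linorder_neqE_nat)

lemma covers_exists:
  assumes "finite P" "x \<in> P" "l \<in> P" "x < l"
  obtains p where "covers P p l"
proof
  let ?A = "{y\<in>P. y < l}"
  have A: "finite ?A" "?A \<noteq> {}" using assms by auto
  show "covers P (Max ?A) l"
    unfolding covers_def using Max_in[OF A] Max_ge[OF A(1)] assms(3) by fastforce
qed

lemma hook_setsD:
  assumes "K \<in> hook_sets full \<pi> P"
  shows "(l, e) \<in> K \<Longrightarrow> l \<in> P" "(l, e) \<in> K \<Longrightarrow> e \<in> P" "(l, e) \<in> K \<Longrightarrow> l \<le> e"
    "(l, e) \<in> K \<Longrightarrow> \<exists>p. covers P p l \<and> \<pi> p < \<pi> e"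
    "(l, e) \<in> K \<Longrightarrow> (l, e') \<in> K \<Longrightarrow> e = e'"
    "required full \<pi> P l \<Longrightarrow> \<exists>e. (l, e) \<in> K"
    "(l, e) \<in> K \<Longrightarrow> (e, e) \<in> K"
    "(l, e) \<in> K \<Longrightarrow> \<exists>l'. required full \<pi> P l' \<and> (l', e) \<in> K"
    "(l, e) \<in> K \<Longrightarrow> (l', e') \<in> K \<Longrightarrow> \<pi> e < \<pi> e' \<Longrightarrow> l \<le> e' \<Longrightarrow> l' \<le> e \<Longrightarrow> l' \<le> l \<and> e \<le> e'"
  using assms unfolding hook_sets_def by (blast+)

lemma hook_setsI:
  assumes "\<And>l e. (l, e) \<in> K \<Longrightarrow> l \<in> P" "\<And>l e. (l, e) \<in> K \<Longrightarrow> e \<in> P"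
    "\<And>l e. (l, e) \<in> K \<Longrightarrow> l \<le> e"
    "\<And>l e. (l, e) \<in> K \<Longrightarrow> \<exists>p. covers P p l \<and> \<pi> p < \<pi> e"
    "\<And>l e e'. (l, e) \<in> K \<Longrightarrow> (l, e') \<in> K \<Longrightarrow> e = e'"
    "\<And>l. required full \<pi> P l \<Longrightarrow> \<exists>e. (l, e) \<in> K"
    "\<And>l e. (l, e) \<in> K \<Longrightarrow> (e, e) \<in> K"
    "\<And>l e. (l, e) \<in> K \<Longrightarrow> \<exists>l'. required full \<pi> P l' \<and> (l', e) \<in> K"
    "\<And>l e l' e'. (l, e) \<in> K \<Longrightarrow> (l', e') \<in> K \<Longrightarrow> \<pi> e < \<pi> e' \<Longrightarrow> l \<le> e' \<Longrightarrow> l' \<le> e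
      \<Longrightarrow> l' \<le> l \<and> e \<le> e'"
  shows "K \<in> hook_sets full \<pi> P"
proof -
  have "K \<subseteq> P \<times> P" using assms(1,2) by auto
  then show ?thesis
    unfolding hook_sets_def mem_Collect_eq
    by (intro conjI allI impI) (assumption | rule assms(3-8) assms(9)[THEN conjunct1] assms(9)[THEN conjunct2])+
qed

lemma finite_hook_sets: "finite P \<Longrightarrow> finite (hook_sets full \<pi> P)"
  by (rule finite_subset[of _ "Pow (P \<times> P)"]) (auto simp: hook_sets_def)

lemma finite_hook_set: "finite P \<Longrightarrow> K \<in> hook_sets full \<pi> P \<Longrightarrow> finite K"
  by (rule finite_subset[of _ "P \<times> P"]) (auto simp: hook_sets_def)

lemma first_hit_unique: "first_hit \<pi> K x h \<Longrightarrow> first_hit \<pi> K x h' \<Longrightarrow> h = h'"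
  unfolding first_hit_def by (metis less_asym less_irrefl le_antisym prod_eqI)

text \<open>
  \<open>B\<close> holds the encoded left ends of the hooks with northeast endpoint \<open>j\<close>; \<open>j\<close> itself is one of
  them, so \<open>inner_part P j B j = {j}\<close>.
\<close>

definition outer_part :: "nat set \<Rightarrow> nat \<Rightarrow> nat set \<Rightarrow> nat set" where
  "outer_part P j B = {x\<in>P. j < x \<or> (\<forall>b\<in>B. x < b)}"

text \<open>The predecessors of the elements of \<open>B\<close> are the children of
  \<open>j\<close>, so the piece that starts at \<open>b < j\<close> ends with the next child: for
  \<open>full = True\<close> it is the subtree of that child. The subtree of the first child stays
  in \<open>outer_part\<close>.\<close>

definition inner_part :: "nat set \<Rightarrow> nat \<Rightarrow> nat set \<Rightarrow> nat \<Rightarrow> nat set" where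
  "inner_part P j B b = {x\<in>P. b \<le> x \<and> x \<le> j \<and> (\<forall>b'\<in>B. b' \<le> x \<longrightarrow> b' \<le> b)}"

section \<open>Decomposition at the hooks with a common northeast endpoint\<close>

text \<open>\<open>below\<close> and \<open>above\<close> make the pieces independent of each other.
  \<open>B_req\<close> supplies the hook at a descent that condition (c) demands at
  \<open>j\<close>.\<close>

locale hook_bundle =
  fixes full :: bool and \<pi> :: "nat \<Rightarrow> nat" and P :: "nat set" and j :: nat and B :: "nat set"
  assumes finP: "finite P" and jP: "j \<in> P" and jB: "j \<in> B" and BP: "B \<subseteq> P"
    and B_le: "b \<in> B \<Longrightarrow> b \<le> j" and B_pred: "b \<in> B \<Longrightarrow> \<exists>p\<in>P. p < b"
    and below: "x \<in> P \<Longrightarrow> x < j \<Longrightarrow> \<pi> x < \<pi> j" and above: "x \<in> P \<Longrightarrow> j < x \<Longrightarrow> \<pi> j < \<pi> x"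
    and B_req: "\<exists>b\<in>B. required full \<pi> P b"
begin

abbreviation outer :: "nat set" where
  "outer \<equiv> outer_part P j B"

abbreviation seg :: "nat \<Rightarrow> nat set" where
  "seg \<equiv> inner_part P j B"

lemmas outer_def = outer_part_def[of P j B]
lemmas seg_def = inner_part_def[of P j B]

definition blk :: "nat option \<Rightarrow> nat set" where
  "blk i = (case i of None \<Rightarrow> outer | Some b \<Rightarrow> seg b)"

definition blks :: "nat option set" where
  "blks = insert None (Some ` B)"

section \<open>The pieces and their predecessor relations\<close>

lemma finB: "finite B" using finP BP finite_subset by blast

lemma finI: "finite blks" by (simp add: blks_def finB)

lemma blk_simps [simp]: "blk None = outer" "blk (Some b) = seg b"
  by (simp_all add: blk_def)

lemma blks_cases:
  assumes "i \<in> blks"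
  obtains "i = None" | b where "b \<in> B" "i = Some b"
  using assms by (auto simp: blks_def)

lemma blk_sub: "x \<in> blk i \<Longrightarrow> x \<in> P"
  by (auto simp: blk_def outer_def seg_def split: option.splits)

lemma blk_cover:
  assumes "x \<in> P"
  obtains i where "i \<in> blks" "x \<in> blk i"
proof (cases "j < x \<or> (\<forall>b\<in>B. x < b)")
  case True
  then show ?thesis using assms that[of None] by (simp add: blks_def outer_def)
next
  case False
  let ?A = "{b\<in>B. b \<le> x}"
  have A: "finite ?A" "?A \<noteq> {}" using False finB by (auto simp: not_less)
  have "Max ?A \<in> B" "Max ?A \<le> x" using Max_in[OF A] by auto
  moreover have "\<forall>b'\<in>B. b' \<le> x \<longrightarrow> b' \<le> Max ?A" using Max_ge[OF A(1)] by simp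
  ultimately have "x \<in> blk (Some (Max ?A))" using assms False by (simp add: seg_def)
  then show ?thesis using that[of "Some (Max ?A)"] \<open>Max ?A \<in> B\<close> by (simp add: blks_def)
qed

lemma blk_unique:
  assumes "i \<in> blks" "i' \<in> blks" "x \<in> blk i" "x \<in> blk i'"
  shows "i = i'"
  using assms by (elim blks_cases) (auto simp: outer_def seg_def intro: antisym dest: leD)

lemma seg_last: "seg j = {j}"
  using jP B_le by (auto simp: seg_def)

text \<open>An element of \<open>B\<close> is the least element of its own piece, and the outer
  piece contains none. So no hook of a piece has its left end in \<open>B\<close>, and these ends
  are free for the hooks to \<open>j\<close>.\<close>

lemma blk_first:
  assumes "i \<in> blks" "b \<in> blk i" "b \<in> B"
  shows "\<not> covers (blk i) p b"
proof -
  have "i = Some b"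
    using assms B_le by (elim blks_cases) (auto simp: outer_def seg_def intro: antisym dest: leD)
  then show ?thesis by (auto simp: covers_def seg_def)
qed

lemma not_required_blk: "i \<in> blks \<Longrightarrow> b \<in> blk i \<Longrightarrow> b \<in> B \<Longrightarrow> \<not> required full \<pi> (blk i) b"
  by (simp add: required_def blk_first)

text \<open>Passing to a piece changes one predecessor only: the position after \<open>j\<close>, if
  there is one, gets the position before \<open>Min B\<close> in place of \<open>j\<close>. The
  second alternative is this seam.\<close>

lemma covers_blk:
  assumes "i \<in> blks" "l \<in> blk i" "l \<notin> B" "covers P p l"
  shows "covers (blk i) p l \<or>
    i = None \<and> p = j \<and> j < l \<and> (\<exists>p0\<in>P. p0 < j \<and> covers (blk i) p0 l)"
  using assms(1)
proof (cases rule: blks_cases)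
  case (2 c)
  then have "c \<le> l" "c \<noteq> l" "c \<in> P" using assms BP by (auto simp: seg_def)
  then have "c \<le> p" using assms(4) unfolding covers_def by (meson le_neq_implies_less not_le)
  then have "p \<in> blk i" using assms 2 by (auto simp: seg_def covers_def)
  then show ?thesis using assms blk_sub by (auto simp: covers_def)
next
  case 1
  consider "\<forall>b\<in>B. l < b" | "j < l" using assms 1 by (auto simp: outer_def)
  then show ?thesis
  proof cases
    case 1
    then have "p \<in> outer" using assms by (auto simp: outer_def covers_def)
    then show ?thesis using assms \<open>i = None\<close> blk_sub[of _ None] by (auto simp: covers_def)
  next
    case 2
    then have "j \<le> p" using assms(4) jP unfolding covers_def by (meson not_le)
    show ?thesis
    proof (cases "j = p")
      case False
      then have "p \<in> outer" using assms \<open>j \<le> p\<close> by (auto simp: outer_def covers_def)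
      then show ?thesis using assms \<open>i = None\<close> blk_sub[of _ None] by (auto simp: covers_def)
    next
      case True
      have B0: "Min B \<in> B" "\<And>b. b \<in> B \<Longrightarrow> Min B \<le> b" using finB jB by (auto intro: Min_in)
      obtain p0 where p0: "covers P p0 (Min B)"
        using B_pred[OF B0(1)] B0(1) BP finP covers_exists by (metis subsetD)
      have "x < l \<longrightarrow> \<not> p0 < x" if "x \<in> outer" for x
      proof -
        have "x \<in> P" "j < x \<or> x < Min B" using that B0(1) by (auto simp: outer_def)
        then show ?thesis using p0 assms(4) True unfolding covers_def by blast
      qed
      moreover have "p0 \<in> outer" using p0 B0(2) by (force simp: outer_def covers_def)
      moreover have "p0 < l" using p0 B_le[OF B0(1)] 2 by (simp add: covers_def)
      ultimately have "covers outer p0 l"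
        using assms(2) \<open>i = None\<close> by (auto simp: covers_def)
      moreover have "p0 < j" using p0 B_le[OF B0(1)] by (auto simp: covers_def)
      moreover have "p0 \<in> P" using p0 by (simp add: covers_def)
      ultimately show ?thesis unfolding \<open>i = None\<close> blk_simps using True 2 by blast
    qed
  qed
qed

lemma covers_blk_exists:
  assumes "i \<in> blks" "covers (blk i) p l"
  obtains p' where "covers P p' l" "l \<in> blk i" "l \<notin> B"
  using assms blk_sub[of _ i] finP blk_first[OF assms(1)] by (meson covers_def covers_exists)

text \<open>At the seam both the old predecessor \<open>j\<close> and the new one lie below
  \<open>l\<close>, so neither gives a descent; elsewhere the predecessor is the same.\<close>

lemma required_blk:
  assumes "i \<in> blks" "l \<in> blk i" "l \<notin> B"
  shows "required full \<pi> P l \<longleftrightarrow> required full \<pi> (blk i) l"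
proof
  assume "required full \<pi> P l"
  then obtain p where p: "covers P p l" "full \<or> \<pi> l < \<pi> p" by (auto simp: required_def)
  have "l \<in> P" using p by (simp add: covers_def)
  from covers_blk[OF assms p(1)] show "required full \<pi> (blk i) l"
    using p above[OF \<open>l \<in> P\<close>] unfolding required_def by fastforce
next
  assume "required full \<pi> (blk i) l"
  then obtain p where p: "covers (blk i) p l" "full \<or> \<pi> l < \<pi> p" by (auto simp: required_def)
  obtain p' where p': "covers P p' l" by (rule covers_blk_exists[OF assms(1) p(1)])
  have "l \<in> P" using p' by (simp add: covers_def)
  from covers_blk[OF assms p'] show "required full \<pi> P l"
  proof
    assume "covers (blk i) p' l"
    then have "p = p'" using p(1) covers_unique by blast
    then show ?thesis using p p' by (auto simp: required_def)
  next
    assume *: "i = None \<and> p' = j \<and> j < l \<and> (\<exists>p0\<in>P. p0 < j \<and> covers (blk i) p0 l)"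
    then have "p \<in> P" "p < j" using covers_unique[OF p(1)] by auto
    then have "\<pi> p < \<pi> l" using * below[of p] above[OF \<open>l \<in> P\<close>] by fastforce
    then show ?thesis using p p' by (auto simp: required_def)
  qed
qed

text \<open>At the seam \<open>l \<le> e\<close> puts \<open>e\<close> after \<open>j\<close>, so
  \<open>e\<close> is higher than both predecessors.\<close>

lemma covers_less_blk:
  assumes "i \<in> blks" "l \<in> blk i" "l \<notin> B" "e \<in> P" "l \<le> e"
  shows "(\<exists>p. covers P p l \<and> \<pi> p < \<pi> e) \<longleftrightarrow> (\<exists>p. covers (blk i) p l \<and> \<pi> p < \<pi> e)"
proof
  assume "\<exists>p. covers P p l \<and> \<pi> p < \<pi> e"
  then obtain p where p: "covers P p l" "\<pi> p < \<pi> e" by blast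
  from covers_blk[OF assms(1-3) p(1)] show "\<exists>p. covers (blk i) p l \<and> \<pi> p < \<pi> e"
    using p below order.strict_trans by blast
next
  assume "\<exists>p. covers (blk i) p l \<and> \<pi> p < \<pi> e"
  then obtain p where p: "covers (blk i) p l" "\<pi> p < \<pi> e" by blast
  obtain p' where p': "covers P p' l" by (rule covers_blk_exists[OF assms(1) p(1)])
  from covers_blk[OF assms(1-3) p'] show "\<exists>p. covers P p l \<and> \<pi> p < \<pi> e"
    using p p' covers_unique above[OF assms(4)] assms(5) by (metis less_le_trans)
qed

section \<open>Cutting a hook set into hook sets on the pieces\<close>

definition res :: "(nat \<times> nat) set \<Rightarrow> nat option \<Rightarrow> (nat \<times> nat) set" where
  "res K i = {(l, e) \<in> K. l \<in> blk i \<and> e \<in> blk i \<and> e \<noteq> j}"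

definition glue :: "(nat option \<Rightarrow> (nat \<times> nat) set) \<Rightarrow> (nat \<times> nat) set" where
  "glue k = B \<times> {j} \<union> (\<Union>i\<in>blks. k i)"

text \<open>Nesting against the hooks \<open>(b, j)\<close> confines every other hook to one piece.
  If it ends before \<open>j\<close> it is lower than they are, so each \<open>b \<le> e\<close>
  satisfies \<open>b \<le> l\<close>; if it ends after \<open>j\<close> it is higher, so it starts
  before all of \<open>B\<close> or after \<open>j\<close>.\<close>

lemma same_blk:
  assumes K: "K \<in> hook_sets full \<pi> P" and B: "{l. (l, j) \<in> K} = B"
    and le: "(l, e) \<in> K" "e \<noteq> j"
  obtains i where "i \<in> blks" "l \<in> blk i" "e \<in> blk i" "l \<notin> B"
proof -
  note D = hook_setsD[OF K]
  have P: "l \<in> P" "e \<in> P" "l \<le> e" using D le by auto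
  have lB: "l \<notin> B" using D(5)[OF le(1)] le(2) B by blast
  have BK: "(b, j) \<in> K" if "b \<in> B" for b using that B by auto
  show ?thesis
  proof (cases "e < j")
    case True
    have *: "b < l" if "b \<in> B" "b \<le> e" for b
    proof -
      have "b \<le> l" using D(9)[OF le(1) BK[OF that(1)]] below[OF P(2) True] True P that by linarith
      then show ?thesis using lB that by (cases "b = l") auto
    qed
    obtain i where i: "i \<in> blks" "e \<in> blk i" using blk_cover[OF P(2)] .
    have "l \<in> blk i" using i(1)
    proof (cases rule: blks_cases)
      case 1
      then show ?thesis using i P True by (auto simp: outer_def)
    next
      case (2 b)
      then show ?thesis using i P True * by (force simp: seg_def)
    qed
    then show ?thesis using that i lB by blast
  next
    case False
    then have "j < e" using le by simp
    then have e: "e \<in> outer" using P by (simp add: outer_def)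
    have "l \<in> outer"
    proof (cases "j < l")
      case True
      then show ?thesis using P by (simp add: outer_def)
    next
      case False
      have "l < b" if "b \<in> B" for b
        using D(9)[OF BK[OF that] le(1)] above[OF P(2) \<open>j < e\<close>] B_le[OF that] \<open>j < e\<close> False that lB
        by (cases "l = b") auto
      then show ?thesis using P by (simp add: outer_def)
    qed
    then show ?thesis using that[of None] e lB by (simp add: blks_def)
  qed
qed

lemma res_in:
  assumes K: "K \<in> hook_sets full \<pi> P" and B: "{l. (l, j) \<in> K} = B" and i: "i \<in> blks"
  shows "res K i \<in> hook_sets full \<pi> (blk i)"
proof -
  note D = hook_setsD[OF K]
  have nB: "l \<notin> B" if "(l, e) \<in> res K i" for l e
    using that D(5)[of l e j] B by (auto simp: res_def)
  show ?thesis
  proof (rule hook_setsI)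
    fix l e assume le: "(l, e) \<in> res K i"
    then have le': "(l, e) \<in> K" "l \<in> blk i" "e \<in> blk i" "e \<noteq> j" by (auto simp: res_def)
    show "l \<in> blk i" "e \<in> blk i" "l \<le> e" using le' D by auto
    show "\<exists>p. covers (blk i) p l \<and> \<pi> p < \<pi> e"
      using covers_less_blk[OF i le'(2) nB[OF le], of e] D(2-4)[OF le'(1)] by blast
    show "(e, e) \<in> res K i" using le' D(7) by (auto simp: res_def)
    obtain l' where l': "required full \<pi> P l'" "(l', e) \<in> K" using D(8)[OF le'(1)] by blast
    obtain i' where i': "i' \<in> blks" "l' \<in> blk i'" "e \<in> blk i'" "l' \<notin> B"
      by (rule same_blk[OF K B l'(2) le'(4)])
    then have "i' = i" using blk_unique i le'(3) by blast
    then show "\<exists>l'. required full \<pi> (blk i) l' \<and> (l', e) \<in> res K i"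
      using required_blk[OF i, of l'] i' l' le' by (auto simp: res_def)
  next
    fix l assume *: "required full \<pi> (blk i) l"
    then have l: "l \<in> blk i" "l \<notin> B" using not_required_blk[OF i] by (auto simp: required_def covers_def)
    then obtain e where e: "(l, e) \<in> K" using required_blk[OF i l] * D(6) by blast
    then have "e \<noteq> j" using l B by auto
    obtain i' where i': "i' \<in> blks" "l \<in> blk i'" "e \<in> blk i'" by (metis same_blk[OF K B e \<open>e \<noteq> j\<close>])
    then have "i' = i" using blk_unique i l by blast
    then show "\<exists>e. (l, e) \<in> res K i" using i' l e \<open>e \<noteq> j\<close> by (auto simp: res_def)
  qed (use D(5,9) in \<open>auto simp: res_def\<close>)
qed

lemma glue_res:
  assumes K: "K \<in> hook_sets full \<pi> P" and B: "{l. (l, j) \<in> K} = B"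
  shows "glue (res K) = K"
proof -
  have "h \<in> glue (res K)" if "h \<in> K" for h
  proof -
    obtain l e where [simp]: "h = (l, e)" by (cases h)
    show ?thesis
    proof (cases "e = j")
      case True
      then show ?thesis using that B by (auto simp: glue_def)
    next
      case False
      have "(l, e) \<in> K" using that by simp
      from same_blk[OF K B this False] obtain i where "i \<in> blks" "l \<in> blk i" "e \<in> blk i" by metis
      then show ?thesis using that False by (auto simp: glue_def res_def)
    qed
  qed
  then show ?thesis using B by (auto simp: glue_def res_def)
qed

lemma prod_blk: "(\<Prod>x\<in>P. f x) = (\<Prod>i\<in>blks. \<Prod>x\<in>blk i. f x)"
proof -
  have "P = (\<Union>i\<in>blks. blk i)" using blk_sub blk_cover by blast
  moreover have "finite (blk i)" for i using finP blk_sub by (metis finite_subset subsetI)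
  moreover have "\<forall>i\<in>blks. \<forall>i'\<in>blks. i \<noteq> i' \<longrightarrow> blk i \<inter> blk i' = {}" using blk_unique by blast
  ultimately show ?thesis using prod.UNION_disjoint[OF finI, of blk f] by metis
qed

section \<open>Gluing hook sets on the pieces\<close>

context
  fixes k assumes k: "\<And>i. i \<in> blks \<Longrightarrow> k i \<in> hook_sets full \<pi> (blk i)"
begin

lemmas kD = hook_setsD[OF k]

lemma k_notB: "i \<in> blks \<Longrightarrow> (l, e) \<in> k i \<Longrightarrow> l \<notin> B"
  using kD(4)[of i l e] kD(1)[of i l e] blk_first[of i l] by metis

lemma k_last: "k (Some j) = {}"
proof -
  have "(l, e) \<notin> k (Some j)" for l e
    using kD(4)[of "Some j" l e] jB by (auto simp: blks_def seg_last covers_def)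
  then show ?thesis by auto
qed

text \<open>The only piece containing \<open>j\<close> is {j}, where no position has a predecessor
  and hence no hook exists.\<close>

lemma k_neq_j: "i \<in> blks \<Longrightarrow> (l, e) \<in> k i \<Longrightarrow> e \<noteq> j"
proof
  assume *: "i \<in> blks" "(l, e) \<in> k i" "e = j"
  then have "j \<in> blk i" using kD(2) by blast
  then have "i = Some j" using blk_unique[OF *(1), of "Some j" j] jB by (simp add: blks_def seg_last)
  then show False using * k_last by simp
qed

lemma glue_cases:
  assumes "(l, e) \<in> glue k"
  obtains "l \<in> B" "e = j" | i where "i \<in> blks" "(l, e) \<in> k i" "l \<notin> B" "e \<noteq> j"
  using assms k_notB k_neq_j unfolding glue_def by (elim UnE UN_E) blast+

lemma k_blk: "i \<in> blks \<Longrightarrow> (l, e) \<in> k i \<Longrightarrow> l \<in> blk i \<and> e \<in> blk i \<and> l \<le> e \<and> l \<in> P \<and> e \<in> P"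
  using kD(1-3) blk_sub by blast

lemma glueI: "b \<in> B \<Longrightarrow> (b, j) \<in> glue k" "i \<in> blks \<Longrightarrow> (l, e) \<in> k i \<Longrightarrow> (l, e) \<in> glue k"
  by (auto simp: glue_def)

lemma k_bundle_below:
  assumes "i \<in> blks" "(l, e) \<in> k i" "b \<in> B" "\<pi> e < \<pi> j" "b \<le> e"
  shows "b \<le> l \<and> e \<le> j"
proof -
  note le = k_blk[OF assms(1,2)]
  have "e < j" using le above[of e] k_neq_j[OF assms(1,2)] assms(4) by (meson linorder_neqE_nat not_less_iff_gr_or_eq)
  show ?thesis using assms(1)
  proof (cases rule: blks_cases)
    case 1
    then show ?thesis using le assms \<open>e < j\<close> by (auto simp: outer_def)
  next
    case (2 c)
    then show ?thesis using le assms \<open>e < j\<close> by (fastforce simp: seg_def)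
  qed
qed

lemma k_bundle_above:
  assumes "i \<in> blks" "(l, e) \<in> k i" "b \<in> B" "\<pi> j < \<pi> e" "l \<le> j"
  shows "l \<le> b \<and> j \<le> e"
proof -
  note le = k_blk[OF assms(1,2)]
  have "j < e" using le below[of e] k_neq_j[OF assms(1,2)] assms(4) by (meson linorder_neqE_nat not_less_iff_gr_or_eq)
  then have "i = None" using assms(1) le by (elim blks_cases) (auto simp: seg_def)
  then show ?thesis using le assms \<open>j < e\<close> by (auto simp: outer_def)
qed

text \<open>Two inner pieces are disjoint intervals, so hooks in them do not overlap. An outer hook
  that overlaps an inner one ends after \<open>j\<close>: it is then the higher of the two and spans
  the whole inner piece.\<close>

lemma k_nested:
  assumes "i \<in> blks" "(l, e) \<in> k i" "i' \<in> blks" "(l', e') \<in> k i'" "\<pi> e < \<pi> e'" "l \<le> e'" "l' \<le> e"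
  shows "l' \<le> l \<and> e \<le> e'"
proof (cases "i = i'")
  case True
  then show ?thesis using kD(9) assms by blast
next
  case False
  note le = k_blk[OF assms(1,2)] and le' = k_blk[OF assms(3,4)]
  from assms(1) show ?thesis
  proof (cases rule: blks_cases)
    case 1
    then obtain c where c: "c \<in> B" "i' = Some c" using False assms(3) by (auto elim: blks_cases)
    then have "e' \<le> j" using le' by (auto simp: seg_def)
    have "\<pi> e' \<le> \<pi> j" using \<open>e' \<le> j\<close> below[of e'] le' by (cases "e' = j") auto
    then have "\<not> j < e" using above[of e] le assms(5) by auto
    then have "\<forall>b\<in>B. e < b" using le 1 by (auto simp: outer_def)
    then show ?thesis using c le' assms(7) by (auto simp: seg_def)
  next
    case (2 c)
    from assms(3) show ?thesis
    proof (cases rule: blks_cases)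
      case 1
      then show ?thesis using le le' 2 assms(6,7) by (fastforce simp: outer_def seg_def)
    next
      case (2 c')
      have "l \<in> seg c" "e \<in> seg c" "l' \<in> seg c'" "e' \<in> seg c'" using le le' 2 \<open>i = Some c\<close> by auto
      moreover from this have "c \<le> e'" "c' \<le> e" using assms(6,7) by (auto simp: seg_def)
      ultimately have "c \<le> c'" "c' \<le> c"
        using \<open>c \<in> B\<close> \<open>c' \<in> B\<close> by (auto simp: seg_def)
      then show ?thesis using False \<open>i = Some c\<close> 2 by simp
    qed
  qed
qed

lemma glue_in: "glue k \<in> hook_sets full \<pi> P"
proof -
  have *: "l \<in> P \<and> e \<in> P \<and> l \<le> e \<and> (e, e) \<in> glue k \<and> (\<exists>p. covers P p l \<and> \<pi> p < \<pi> e)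
    \<and> (\<exists>l'. required full \<pi> P l' \<and> (l', e) \<in> glue k)" if "(l, e) \<in> glue k" for l e
    using that
  proof (cases rule: glue_cases)
    case 1
    obtain p where p: "covers P p l" using B_pred[OF 1(1)] 1 BP finP covers_exists by (metis subsetD)
    have "p \<in> P" "p < j" using p B_le[OF 1(1)] by (auto simp: covers_def)
    then have "\<pi> p < \<pi> j" by (rule below)
    then show ?thesis
      using 1 p BP jP jB B_le B_req glueI by blast
  next
    case (2 i)
    note le = k_blk[OF 2(1,2)]
    obtain l' where l': "required full \<pi> (blk i) l'" "(l', e) \<in> k i" using kD(8)[OF 2(1,2)] by blast
    have "required full \<pi> P l'"
      using required_blk[OF 2(1), of l'] l' k_notB[OF 2(1)] kD(1)[OF 2(1)] by blast
    moreover have "\<exists>p. covers P p l \<and> \<pi> p < \<pi> e"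
      using covers_less_blk[OF 2(1) _ 2(3)] le kD(4)[OF 2(1,2)] by blast
    moreover have "(e, e) \<in> k i" using kD(7)[OF 2(1,2)] .
    ultimately show ?thesis
      using le l' glueI(2)[OF 2(1)] by blast
  qed
  show ?thesis
  proof (rule hook_setsI)
  fix l e e' assume "(l, e) \<in> glue k" "(l, e') \<in> glue k"
  then show "e = e'"
  proof (cases rule: glue_cases)
    case 1
    from \<open>(l, e') \<in> glue k\<close> show ?thesis by (cases rule: glue_cases) (use 1 in auto)
  next
    case (2 i)
    from \<open>(l, e') \<in> glue k\<close> show ?thesis
    proof (cases rule: glue_cases)
      case (2 i')
      then have "i' = i" using \<open>i \<in> blks\<close> \<open>(l, e) \<in> k i\<close> k_blk blk_unique by metis
      then show ?thesis using 2 \<open>i \<in> blks\<close> \<open>(l, e) \<in> k i\<close> kD(5) by blast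
    qed (use 2 in simp)
  qed
next
  fix l assume *: "required full \<pi> P l"
  show "\<exists>e. (l, e) \<in> glue k"
  proof (cases "l \<in> B")
    case True
    then show ?thesis using glueI by blast
  next
    case False
    have "l \<in> P" using * by (auto simp: required_def covers_def)
    then obtain i where i: "i \<in> blks" "l \<in> blk i" by (rule blk_cover)
    then show ?thesis using required_blk[OF i False] * kD(6)[OF i(1)] glueI by blast
  qed
next
  fix l e l' e' assume "(l, e) \<in> glue k" "(l', e') \<in> glue k" and *: "\<pi> e < \<pi> e'" "l \<le> e'" "l' \<le> e"
  then show "l' \<le> l \<and> e \<le> e'"
  proof (cases rule: glue_cases)
    case 1
    from \<open>(l', e') \<in> glue k\<close> show ?thesis
      by (cases rule: glue_cases) (use * 1 k_bundle_above in auto)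
  next
    case (2 i)
    from \<open>(l', e') \<in> glue k\<close> show ?thesis
    proof (cases rule: glue_cases)
      case 1
      then show ?thesis using * k_bundle_below[OF 2(1,2)] by simp
    next
      case (2 i')
      then show ?thesis using * k_nested[OF \<open>i \<in> blks\<close> \<open>(l, e) \<in> k i\<close> 2(1,2)] by simp
    qed
  qed
qed (use * in blast)+
qed

lemma glue_lefts: "{l. (l, j) \<in> glue k} = B"
proof -
  have "l \<in> B" if "(l, j) \<in> glue k" for l
    using that by (cases rule: glue_cases) auto
  then show ?thesis using glueI(1) by blast
qed

lemma res_glue: "i \<in> blks \<Longrightarrow> res (glue k) i = k i"
proof -
  assume i: "i \<in> blks"
  have "(l, e) \<in> res (glue k) i \<longleftrightarrow> (l, e) \<in> k i" for l e
  proof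
    assume "(l, e) \<in> res (glue k) i"
    then have "(l, e) \<in> glue k" "e \<noteq> j" "l \<in> blk i" by (auto simp: res_def)
    from this(1) show "(l, e) \<in> k i"
    proof (cases rule: glue_cases)
      case (2 i')
      then have "i' = i" using i \<open>l \<in> blk i\<close> k_blk blk_unique by metis
      then show ?thesis using 2 by simp
    qed (use \<open>e \<noteq> j\<close> in simp)
  next
    assume "(l, e) \<in> k i"
    then show "(l, e) \<in> res (glue k) i"
      using i k_blk[OF i] k_neq_j glueI by (auto simp: res_def)
  qed
  then show ?thesis by auto
qed

section \<open>Hits, color classes and weights of a glued hook set\<close>

lemmas k_facts = k_blk k_neq_j

lemma mem_glue_iff:
  assumes "i \<in> blks" "x \<in> blk i"
  shows "(l, x) \<in> glue k \<longleftrightarrow> (x = j \<and> l \<in> B) \<or> (l, x) \<in> k i"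
  using assms glueI glue_cases[of l x] k_facts(1) blk_unique by metis

lemma lefts_glue:
  assumes "i \<in> blks" "x \<in> blk i"
  shows "(d choose card {l. (l, x) \<in> glue k}) =
    (if x = j then d choose card B else 1) * (d choose card {l. (l, x) \<in> k i})"
proof (cases "x = j")
  case True
  then have "(l, x) \<notin> k i" for l using k_facts(2)[OF assms(1)] by blast
  then show ?thesis using True mem_glue_iff[OF assms] by simp
qed (use mem_glue_iff[OF assms] in simp)

text \<open>Hooks of the bundle and of inner pieces cover only positions from \<open>Min B\<close>
  to \<open>j\<close>, and none of these is in \<open>outer\<close>.\<close>

lemma hit_glue_outer:
  assumes "x \<in> outer"
  shows "hit \<pi> (glue k) x h \<longleftrightarrow> hit \<pi> (k None) x h"
proof
  assume h: "hit \<pi> (glue k) x h"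
  obtain l e where le: "h = (l, e)" by (cases h)
  then have "(l, e) \<in> glue k" "l \<le> x" "x \<le> e" using h by (auto simp: hit_def)
  from this(1) have "(l, e) \<in> k None"
  proof (cases rule: glue_cases)
    case shared: 1
    then show ?thesis using assms \<open>l \<le> x\<close> \<open>x \<le> e\<close> by (auto simp: outer_def)
  next
    case inner: (2 i)
    from \<open>i \<in> blks\<close> show ?thesis
    proof (cases rule: blks_cases)
      case (2 c)
      then show ?thesis
        using assms \<open>l \<le> x\<close> \<open>x \<le> e\<close> k_facts(1)[OF inner(1,2)] by (fastforce simp: outer_def seg_def)
    qed (use inner in simp)
  qed
  then show "hit \<pi> (k None) x h" using h le by (simp add: hit_def)
qed (use glueI(2)[of None "fst h" "snd h"] in \<open>auto simp: hit_def blks_def\<close>)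

text \<open>The hooks over a point of an inner piece come in three layers: those of the piece end
  below \<pi> j, those of the bundle at \<pi> j, outer hooks above \<pi> j. So the piece decides the
  first hit, and the bundle takes over where the piece has none.\<close>

lemma hit_glue_seg:
  assumes "c \<in> B" "x \<in> seg c" "hit \<pi> (glue k) x h"
  shows "hit \<pi> (k (Some c)) x h \<or> snd h = j \<and> fst h \<le> c \<or> \<pi> j < \<pi> (snd h)"
proof -
  obtain l e where le: "h = (l, e)" by (cases h)
  have lex: "(l, e) \<in> glue k" "l \<le> x" "x \<le> e" using assms(3) le by (auto simp: hit_def)
  from lex(1) show ?thesis
  proof (cases rule: glue_cases)
    case shared: 1
    then show ?thesis using assms(2) lex le by (auto simp: seg_def)
  next
    case inner: (2 i)
    note lk = k_facts(1)[OF inner(1,2)]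
    from \<open>i \<in> blks\<close> show ?thesis
    proof (cases rule: blks_cases)
      case 1
      have "e \<in> outer" "c \<le> e" using lk 1 assms(2) lex by (auto simp: seg_def)
      then have "j < e" using assms(1) by (auto simp: outer_def)
      then show ?thesis using above lk le by simp
    next
      case (2 b)
      have "l \<in> seg b" "e \<in> seg b" using lk 2 by auto
      moreover have "c \<le> e" "b \<le> x" using calculation lex assms(2) by (auto simp: seg_def)
      ultimately have "b = c" using assms(1,2) \<open>b \<in> B\<close> by (auto simp: seg_def intro: antisym)
      then show ?thesis using inner 2 assms(3) le by (simp add: hit_def)
    qed
  qed
qed

lemma hit_seg_less:
  assumes "c \<in> B" "hit \<pi> (k (Some c)) x h"
  shows "\<pi> (snd h) < \<pi> j" "hit \<pi> (glue k) x h"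
proof -
  obtain l e where le: "h = (l, e)" by (cases h)
  have i: "Some c \<in> blks" using assms by (simp add: blks_def)
  have lk: "(l, e) \<in> k (Some c)" using assms le by (simp add: hit_def)
  then have "e \<in> seg c" "e \<noteq> j" using k_facts[OF i] by auto
  then show "\<pi> (snd h) < \<pi> j" using below[of e] le by (auto simp: seg_def)
  show "hit \<pi> (glue k) x h" using glueI(2)[OF i lk] assms le by (simp add: hit_def)
qed

lemma hit_glue_bundle:
  assumes "c \<in> B" "x \<in> seg c"
  shows "hit \<pi> (glue k) x (c, j)"
proof -
  have "\<pi> x \<le> \<pi> j" using below[of x] assms by (cases "x = j") (auto simp: seg_def)
  then show ?thesis using assms glueI(1) by (auto simp: hit_def seg_def)
qed

lemma first_hit_glue_outer:
  "x \<in> outer \<Longrightarrow> first_hit \<pi> (glue k) x h \<longleftrightarrow> first_hit \<pi> (k None) x h"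
  by (simp add: first_hit_def hit_glue_outer)

lemma first_hit_glue_seg_hit:
  assumes "c \<in> B" "x \<in> seg c" "hit \<pi> (k (Some c)) x h0"
  shows "first_hit \<pi> (glue k) x h \<longleftrightarrow> first_hit \<pi> (k (Some c)) x h"
proof
  assume h: "first_hit \<pi> (glue k) x h"
  then have "\<pi> (snd h) \<le> \<pi> (snd h0)"
    using hit_seg_less[OF assms(1,3)] unfolding first_hit_def by fastforce
  then have "\<pi> (snd h) < \<pi> j" using hit_seg_less[OF assms(1,3)] by simp
  moreover have "\<pi> (snd h) \<noteq> \<pi> j" using calculation by simp
  ultimately have "hit \<pi> (k (Some c)) x h"
    using hit_glue_seg[OF assms(1,2), of h] h unfolding first_hit_def by (metis less_asym)
  then show "first_hit \<pi> (k (Some c)) x h" using h hit_seg_less(2)[OF assms(1)] by (simp add: first_hit_def)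
next
  assume h: "first_hit \<pi> (k (Some c)) x h"
  then have hh: "hit \<pi> (k (Some c)) x h" by (simp add: first_hit_def)
  have "\<pi> (snd h) < \<pi> (snd h') \<or> snd h = snd h' \<and> fst h' \<le> fst h" if "hit \<pi> (glue k) x h'" for h'
    using hit_glue_seg[OF assms(1,2) that] h hit_seg_less(1)[OF assms(1) hh]
    unfolding first_hit_def by (metis less_trans)
  then show "first_hit \<pi> (glue k) x h" using hit_seg_less(2)[OF assms(1) hh] by (simp add: first_hit_def)
qed

text \<open>The bundle hooks over \<open>x\<close> have left ends at most \<open>c\<close>, so the
  tie at height \<pi> j goes to \<open>(c, j)\<close>.\<close>

lemma first_hit_glue_seg_nohit:
  assumes "c \<in> B" "x \<in> seg c" "\<forall>h. \<not> hit \<pi> (k (Some c)) x h"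
  shows "first_hit \<pi> (glue k) x h \<longleftrightarrow> h = (c, j)"
proof -
  have "first_hit \<pi> (glue k) x (c, j)"
    using hit_glue_bundle[OF assms(1,2)] hit_glue_seg[OF assms(1,2)] assms(3)
    unfolding first_hit_def by fastforce
  then show ?thesis using first_hit_unique by blast
qed

lemma no_hit_glue:
  assumes "x \<in> P"
  shows "(\<forall>h. \<not> hit \<pi> (glue k) x h) \<longleftrightarrow> x \<in> outer \<and> (\<forall>h. \<not> hit \<pi> (k None) x h)"
proof -
  obtain i where i: "i \<in> blks" "x \<in> blk i" by (rule blk_cover[OF assms])
  from i(1) show ?thesis
  proof (cases rule: blks_cases)
    case 1
    then show ?thesis using i hit_glue_outer by simp
  next
    case (2 c)
    then have "x \<notin> outer" using blk_unique[OF i(1), of None x] i by (auto simp: blks_def)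
    then show ?thesis using hit_glue_bundle[of c x] 2 i by auto
  qed
qed

lemma first_hit_bundle:
  assumes "x \<in> P" "b \<in> B"
  shows "first_hit \<pi> (glue k) x (b, j) \<longleftrightarrow> x \<in> seg b \<and> (\<forall>h. \<not> hit \<pi> (k (Some b)) x h)"
proof
  assume h: "first_hit \<pi> (glue k) x (b, j)"
  obtain i where i: "i \<in> blks" "x \<in> blk i" by (rule blk_cover[OF assms(1)])
  have nk: "(b, j) \<notin> k i'" if "i' \<in> blks" for i' using k_facts(2)[OF that] by blast
  from i(1) show "x \<in> seg b \<and> (\<forall>h. \<not> hit \<pi> (k (Some b)) x h)"
  proof (cases rule: blks_cases)
    case 1
    then have "first_hit \<pi> (k None) x (b, j)" using h first_hit_glue_outer i by simp
    then show ?thesis using nk[of None] by (simp add: first_hit_def hit_def blks_def)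
  next
    case (2 c)
    then have x: "x \<in> seg c" using i by simp
    have "\<forall>h. \<not> hit \<pi> (k (Some c)) x h"
    proof (rule ccontr)
      assume "\<not> ?thesis"
      then have "first_hit \<pi> (k (Some c)) x (b, j)" using first_hit_glue_seg_hit[OF 2(1) x] h by blast
      then show False using nk i 2 by (auto simp: first_hit_def hit_def)
    qed
    then show ?thesis using first_hit_glue_seg_nohit[OF 2(1) x] h x by auto
  qed
qed (use first_hit_glue_seg_nohit[OF assms(2)] in blast)

lemma first_hit_inner:
  assumes "x \<in> P" "i \<in> blks" "h \<in> k i"
  shows "first_hit \<pi> (glue k) x h \<longleftrightarrow> x \<in> blk i \<and> first_hit \<pi> (k i) x h"
proof -
  obtain l e where le: "h = (l, e)" by (cases h)
  obtain i' where i': "i' \<in> blks" "x \<in> blk i'" by (rule blk_cover[OF assms(1)])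
  have eq: "h \<in> k i' \<longleftrightarrow> i' = i" using assms i'(1) k_facts(1) le blk_unique by metis
  have "snd h \<noteq> j" using k_facts(2) assms le by auto
  have "first_hit \<pi> (glue k) x h \<longleftrightarrow> first_hit \<pi> (k i') x h"
    using i'(1)
  proof (cases rule: blks_cases)
    case 1
    then show ?thesis using first_hit_glue_outer i' by simp
  next
    case (2 c)
    then have x: "x \<in> seg c" using i' by simp
    show ?thesis
    proof (cases "\<forall>h. \<not> hit \<pi> (k (Some c)) x h")
      case True
      then show ?thesis
        using first_hit_glue_seg_nohit[OF 2(1) x True] \<open>snd h \<noteq> j\<close> 2 unfolding first_hit_def
        by (metis snd_conv)
    next
      case False
      then show ?thesis using first_hit_glue_seg_hit[OF 2(1) x] 2 by metis
    qed
  qed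
  moreover have "first_hit \<pi> (k i') x h \<longrightarrow> i' = i" using eq by (auto simp: first_hit_def hit_def)
  moreover have "x \<in> blk i \<longrightarrow> i' = i" using blk_unique i' assms by blast
  ultimately show ?thesis using i' by blast
qed

text \<open>Every color class of the glued set is a color class of one piece: \<open>c_0\<close> of
  \<open>outer\<close> stays \<open>c_0\<close>, \<open>c_0\<close> of \<open>seg b\<close> becomes
  the class of \<open>(b, j)\<close>, and the other classes are unchanged. The new factor is the
  binomial at \<open>j\<close>, where no hook of a piece ends.\<close>

lemma weight_glue:
  "weight E d \<pi> P (glue k) = (d choose card B) * (\<Prod>i\<in>blks. weight E d \<pi> (blk i) (k i))"
proof -
  let ?E = "\<lambda>i. E (card {x\<in>blk i. \<forall>h. \<not> hit \<pi> (k i) x h})"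
  let ?H = "\<lambda>i. \<Prod>h\<in>k i. E (card {x\<in>blk i. first_hit \<pi> (k i) x h})"
  let ?f = "\<lambda>h. E (card {x\<in>P. first_hit \<pi> (glue k) x h})"
  have fink: "finite (k i)" if "i \<in> blks" for i
    using k[OF that] finP blk_sub finite_hook_set by (metis finite_subset subsetI)
  have "(\<Prod>x\<in>P. d choose card {l. (l, x) \<in> glue k}) =
      (\<Prod>x\<in>P. if x = j then d choose card B else 1) *
      (\<Prod>i\<in>blks. \<Prod>x\<in>blk i. d choose card {l. (l, x) \<in> k i})"
    unfolding prod_blk by (simp add: lefts_glue prod.distrib)
  then have 1: "(\<Prod>x\<in>P. d choose card {l. (l, x) \<in> glue k}) =
      (d choose card B) * (\<Prod>i\<in>blks. \<Prod>x\<in>blk i. d choose card {l. (l, x) \<in> k i})"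
    using finP jP by (simp add: prod.delta)
  have "{x\<in>P. \<forall>h. \<not> hit \<pi> (glue k) x h} = {x\<in>outer. \<forall>h. \<not> hit \<pi> (k None) x h}"
    using no_hit_glue blk_sub[of _ None] unfolding blk_simps by blast
  then have 2: "E (card {x\<in>P. \<forall>h. \<not> hit \<pi> (glue k) x h}) = ?E None" by simp
  have disj: "(B \<times> {j}) \<inter> (\<Union>i\<in>blks. k i) = {}" using k_facts(2) by blast
  have "(\<Prod>h\<in>glue k. ?f h) = (\<Prod>h\<in>B \<times> {j}. ?f h) * (\<Prod>h\<in>(\<Union>i\<in>blks. k i). ?f h)"
    unfolding glue_def by (rule prod.union_disjoint) (use finB finI fink disj in auto)
  also have "(\<Prod>h\<in>B \<times> {j}. ?f h) = (\<Prod>b\<in>B. ?f (b, j))"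
    by (rule prod.reindex_bij_witness[of _ "\<lambda>b. (b, j)" fst]) auto
  also have "\<dots> = (\<Prod>b\<in>B. ?E (Some b))"
  proof (rule prod.cong)
    fix b assume "b \<in> B"
    then have "{x\<in>P. first_hit \<pi> (glue k) x (b, j)} = {x\<in>seg b. \<forall>h. \<not> hit \<pi> (k (Some b)) x h}"
      using first_hit_bundle by (auto simp: seg_def)
    then show "?f (b, j) = ?E (Some b)" by simp
  qed simp
  also have "(\<Prod>h\<in>(\<Union>i\<in>blks. k i). ?f h) = (\<Prod>i\<in>blks. \<Prod>h\<in>k i. ?f h)"
  proof (rule prod.UNION_disjoint)
    show "\<forall>i\<in>blks. \<forall>i'\<in>blks. i \<noteq> i' \<longrightarrow> k i \<inter> k i' = {}"
      using k_facts(1) blk_unique by (metis disjoint_iff surj_pair)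
  qed (use finI fink in auto)
  also have "\<dots> = (\<Prod>i\<in>blks. ?H i)"
  proof (intro prod.cong refl)
    fix i h assume "i \<in> blks" "h \<in> k i"
    then have "{x\<in>P. first_hit \<pi> (glue k) x h} = {x\<in>blk i. first_hit \<pi> (k i) x h}"
      using first_hit_inner blk_sub by blast
    then show "?f h = E (card {x\<in>blk i. first_hit \<pi> (k i) x h})" by simp
  qed
  finally have "E (card {x\<in>P. \<forall>h. \<not> hit \<pi> (glue k) x h}) * (\<Prod>h\<in>glue k. ?f h) =
      (?E None * (\<Prod>b\<in>B. ?E (Some b))) * (\<Prod>i\<in>blks. ?H i)"
    using 2 by simp
  also have "?E None * (\<Prod>b\<in>B. ?E (Some b)) = (\<Prod>i\<in>blks. ?E i)"
    using finB by (simp add: blks_def prod.reindex)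
  finally show ?thesis
    unfolding weight_def 1 by (simp add: prod.distrib)
qed

end

lemma sum_bundle:
  "(\<Sum>K\<in>{K\<in>hook_sets full \<pi> P. {l. (l, j) \<in> K} = B}. weight E d \<pi> P K) =
    (d choose card B) * (hook_total full E d \<pi> outer * (\<Prod>b\<in>B. hook_total full E d \<pi> (seg b)))"
proof -
  let ?X = "\<Pi>\<^sub>E i\<in>blks. hook_sets full \<pi> (blk i)"
  let ?Y = "{K\<in>hook_sets full \<pi> P. {l. (l, j) \<in> K} = B}"
  have X: "i \<in> blks \<Longrightarrow> k i \<in> hook_sets full \<pi> (blk i)" if "k \<in> ?X" for k i using that by blast
  have fin: "finite (hook_sets full \<pi> (blk i))" for i
    using finite_hook_sets finite_subset[OF _ finP] blk_sub by (metis subsetI)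
  \<comment> \<open>\<open>glue\<close> sees a family on \<open>blks\<close> only. Extensional
    families make it a bijection, and the sum over them becomes a product of sums.\<close>
  have glue_cong: "glue (restrict k blks) = glue k" for k by (auto simp: glue_def)
  have "bij_betw glue ?X ?Y"
  proof (rule bij_betw_byWitness[where f' = "\<lambda>K. restrict (res K) blks"])
    show "\<forall>k\<in>?X. restrict (res (glue k)) blks = k"
    proof (intro ballI ext)
      fix k i assume k: "k \<in> ?X"
      show "restrict (res (glue k)) blks i = k i"
        using res_glue[OF X[OF k]] PiE_arb[OF k] by (cases "i \<in> blks") auto
    qed
    show "\<forall>K\<in>?Y. glue (restrict (res K) blks) = K" using glue_res glue_cong by simp
    show "glue ` ?X \<subseteq> ?Y" proof (intro image_subsetI CollectI conjI)
      fix k assume k: "k \<in> ?X"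
      show "glue k \<in> hook_sets full \<pi> P" "{l. (l, j) \<in> glue k} = B"
        using glue_in[OF X[OF k]] glue_lefts[OF X[OF k]] by blast+
    qed
    show "(\<lambda>K. restrict (res K) blks) ` ?Y \<subseteq> ?X" using res_in by auto
  qed
  then have "(\<Sum>K\<in>?Y. weight E d \<pi> P K) = (\<Sum>k\<in>?X. weight E d \<pi> P (glue k))"
    by (rule sum.reindex_bij_betw[symmetric])
  also have "\<dots> = (\<Sum>k\<in>?X. (d choose card B) * (\<Prod>i\<in>blks. weight E d \<pi> (blk i) (k i)))"
    by (intro sum.cong weight_glue X) auto
  also have "\<dots> = (d choose card B) * (\<Prod>i\<in>blks. hook_total full E d \<pi> (blk i))"
    using fin finI unfolding hook_total_def by (subst prod_sum_PiE) (auto simp: sum_distrib_left)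
  also have "(\<Prod>i\<in>blks. hook_total full E d \<pi> (blk i)) =
      hook_total full E d \<pi> outer * (\<Prod>b\<in>B. hook_total full E d \<pi> (seg b))"
    using finB by (simp add: blks_def prod.reindex)
  finally show ?thesis .
qed

end

section \<open>Recurrence at the highest descent\<close>

text \<open>\<open>p\<close> is the last position before \<open>y\<close> that is at least as high
  as \<open>x\<close>; its successor is lower than \<open>x\<close> by this choice, or because it is
  \<open>y\<close>.\<close>

lemma descent_between:
  fixes \<pi> :: "nat \<Rightarrow> nat"
  assumes "finite P" "x \<in> P" "y \<in> P" "x < y" "\<pi> y < \<pi> x"
  obtains p l where "covers P p l" "\<pi> l < \<pi> p" "\<pi> x \<le> \<pi> p"
proof -
  let ?A = "{z\<in>P. z < y \<and> \<pi> x \<le> \<pi> z}"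
  have "x \<in> ?A" using assms by simp
  then have A: "finite ?A" "?A \<noteq> {}" using assms(1) by auto
  define p where "p = Max ?A"
  have p: "p \<in> P" "p < y" "\<pi> x \<le> \<pi> p" using Max_in[OF A] by (auto simp: p_def)
  have p_max: "z \<le> p" if "z \<in> P" "z < y" "\<pi> x \<le> \<pi> z" for z
    using Max_ge[OF A(1)] that by (simp add: p_def)
  let ?B = "{z\<in>P. p < z}"
  have B: "finite ?B" "?B \<noteq> {}" using assms p by auto
  define l where "l = Min ?B"
  have l: "l \<in> P" "p < l" using Min_in[OF B] by (auto simp: l_def)
  have l_min: "l \<le> z" if "z \<in> P" "p < z" for z
    using Min_le[OF B(1)] that by (simp add: l_def)
  have "covers P p l" using p l l_min by (fastforce simp: covers_def)
  moreover have "\<pi> l < \<pi> x"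
    using l_min[OF assms(3) p(2)] p_max[of l] l assms(5) by (metis le_neq_implies_less not_le)
  ultimately show ?thesis using that p by force
qed

lemma covers_succ_exists:
  assumes "finite P" "p \<in> P" "x \<in> P" "p < x"
  obtains l where "covers P p l"
proof
  let ?A = "{y\<in>P. p < y}"
  have A: "finite ?A" "?A \<noteq> {}" using assms by auto
  show "covers P p (Min ?A)"
    unfolding covers_def using Min_in[OF A] Min_le[OF A(1)] assms(2) by fastforce
qed

text \<open>The recurrences at the highest descent and at the root differ only in the endpoint
  singled out. \<open>D\<close> lists the pairs \<open>(j, B)\<close> that can occur, and each hook
  set selects exactly one of them.\<close>

lemma hook_total_split:
  assumes fin: "finite P" and finD: "finite D"
    and bun: "\<And>j B. (j, B) \<in> D \<Longrightarrow> hook_bundle full \<pi> P j B"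
    and ex: "\<And>K. K \<in> hook_sets full \<pi> P \<Longrightarrow> \<exists>j. (j, {l. (l, j) \<in> K}) \<in> D"
    and uniq: "\<And>K j j'. K \<in> hook_sets full \<pi> P \<Longrightarrow> (j, {l. (l, j) \<in> K}) \<in> D \<Longrightarrow>
      (j', {l. (l, j') \<in> K}) \<in> D \<Longrightarrow> j = j'"
  shows "hook_total full E d \<pi> P = (\<Sum>(j, B)\<in>D. (d choose card B) *
    (hook_total full E d \<pi> (outer_part P j B) * (\<Prod>b\<in>B. hook_total full E d \<pi> (inner_part P j B b))))"
proof -
  let ?H = "\<lambda>(j, B). {K\<in>hook_sets full \<pi> P. {l. (l, j) \<in> K} = B}"
  have "hook_sets full \<pi> P = (\<Union>z\<in>D. ?H z)"
  proof (intro equalityI subsetI)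
    fix K assume K: "K \<in> hook_sets full \<pi> P"
    then obtain j where "(j, {l. (l, j) \<in> K}) \<in> D" using ex by blast
    then show "K \<in> (\<Union>z\<in>D. ?H z)" using K by (rule_tac UN_I) auto
  qed auto
  then have "hook_total full E d \<pi> P = (\<Sum>K\<in>(\<Union>z\<in>D. ?H z). weight E d \<pi> P K)"
    by (simp add: hook_total_def)
  also have "\<dots> = (\<Sum>z\<in>D. \<Sum>K\<in>?H z. weight E d \<pi> P K)"
  proof (rule sum.UNION_disjoint[OF finD])
    show "\<forall>z\<in>D. finite (?H z)" using finite_hook_sets[OF fin] by auto
    have "z = z'" if "z \<in> D" "z' \<in> D" "K \<in> ?H z" "K \<in> ?H z'" for z z' K
    proof -
      obtain j B j' B' where z: "z = (j, B)" "z' = (j', B')" by fastforce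
      then have B: "B = {l. (l, j) \<in> K}" "B' = {l. (l, j') \<in> K}" and K: "K \<in> hook_sets full \<pi> P"
        using that by auto
      then have "j = j'" using uniq[OF K] that z by blast
      then show ?thesis using z B by simp
    qed
    then show "\<forall>z\<in>D. \<forall>z'\<in>D. z \<noteq> z' \<longrightarrow> ?H z \<inter> ?H z' = {}" by blast
  qed
  also have "\<dots> = (\<Sum>(j, B)\<in>D. (d choose card B) *
    (hook_total full E d \<pi> (outer_part P j B) * (\<Prod>b\<in>B. hook_total full E d \<pi> (inner_part P j B b))))"
  proof (rule sum.cong[OF refl])
    fix z assume "z \<in> D"
    then obtain j B where z: "z = (j, B)" "(j, B) \<in> D" by (cases z) auto
    show "(\<Sum>K\<in>?H z. weight E d \<pi> P K) = (case z of (j, B) \<Rightarrow> (d choose card B) *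
      (hook_total full E d \<pi> (outer_part P j B) * (\<Prod>b\<in>B. hook_total full E d \<pi> (inner_part P j B b))))"
      unfolding z prod.case by (rule hook_bundle.sum_bundle[OF bun[OF z(2)]])
  qed
  finally show ?thesis .
qed

text \<open>The possible endpoints \<open>j\<close> of the hook from \<open>i\<close>, whose
  encoding has left end \<open>l\<close>, each with a candidate set of all left ends of hooks to
  \<open>j\<close>; \<open>j \<in> B\<close> stands for the hook from the predecessor of
  \<open>j\<close>.\<close>

definition descent_bundles :: "(nat \<Rightarrow> nat) \<Rightarrow> nat set \<Rightarrow> nat \<Rightarrow> nat \<Rightarrow> (nat \<times> nat set) set" where
  "descent_bundles \<pi> P i l = {(j, B). j \<in> P \<and> l \<le> j \<and> \<pi> i < \<pi> j \<and>
     B \<subseteq> {b\<in>P. b \<le> j \<and> (\<exists>p\<in>P. p < b)} \<and> j \<in> B \<and> l \<in> B}"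

lemma hook_total_descent:
  assumes fin: "finite P" and inj: "inj_on \<pi> P" and il: "covers P i l" "\<pi> l < \<pi> i"
    and max: "\<And>p l'. covers P p l' \<Longrightarrow> \<pi> l' < \<pi> p \<Longrightarrow> \<pi> p \<le> \<pi> i"
  shows "hook_total full E d \<pi> P = (\<Sum>(j, B)\<in>descent_bundles \<pi> P i l. (d choose card B) *
    (hook_total full E d \<pi> (outer_part P j B) * (\<Prod>b\<in>B. hook_total full E d \<pi> (inner_part P j B b))))"
proof (rule hook_total_split[OF fin])
  have "descent_bundles \<pi> P i l \<subseteq> P \<times> Pow P" by (auto simp: descent_bundles_def)
  then show "finite (descent_bundles \<pi> P i l)" using fin by (simp add: finite_subset)
  \<comment> \<open>An inversion with larger entry above \<pi> i would contain a descent with too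
    high a top. Taking \<open>j\<close> as its left or right entry gives \<open>above\<close> and
    \<open>below\<close>.\<close>
  have no_inv: False if "x \<in> P" "y \<in> P" "x < y" "\<pi> y < \<pi> x" "\<pi> i < \<pi> x" for x y
    using descent_between[OF fin that(1-4)] max that(5) by (metis le_trans not_le)
  have req: "required full \<pi> P l" using il by (auto simp: required_def)
  {
    fix j B assume "(j, B) \<in> descent_bundles \<pi> P i l"
    then have jB: "j \<in> P" "l \<le> j" "\<pi> i < \<pi> j" "j \<in> B" "l \<in> B"
      "B \<subseteq> {b\<in>P. b \<le> j \<and> (\<exists>p\<in>P. p < b)}" by (auto simp: descent_bundles_def)
    have below: "\<pi> x < \<pi> j" if "x \<in> P" "x < j" for x
      using no_inv[of x j] that jB inj_onD[OF inj, of x j] by (metis less_trans linorder_neqE_nat less_irrefl)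
    have above: "\<pi> j < \<pi> x" if "x \<in> P" "j < x" for x
      using no_inv[of j x] that jB inj_onD[OF inj, of j x] by (metis linorder_neqE_nat less_irrefl)
    show "hook_bundle full \<pi> P j B"
      by unfold_locales (use fin inj jB below above req in auto)
  }
  fix K assume K: "K \<in> hook_sets full \<pi> P"
  note D = hook_setsD[OF K]
  obtain j where j: "(l, j) \<in> K" using D(6)[OF req] by blast
  obtain p where "covers P p l" "\<pi> p < \<pi> j" using D(4)[OF j] by blast
  then have "\<pi> i < \<pi> j" using covers_unique[OF il(1)] by auto
  have pre: "\<exists>p\<in>P. p < b" if "(b, j) \<in> K" for b
    using D(4)[OF that] by (auto simp: covers_def)
  show "\<exists>j. (j, {b. (b, j) \<in> K}) \<in> descent_bundles \<pi> P i l"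
    using j D(7)[OF j] D(1-3) pre \<open>\<pi> i < \<pi> j\<close> by (intro exI[of _ j]) (auto simp: descent_bundles_def)
  show "j' = j''" if "(j', {b. (b, j') \<in> K}) \<in> descent_bundles \<pi> P i l"
    "(j'', {b. (b, j'') \<in> K}) \<in> descent_bundles \<pi> P i l" for j' j''
    using that D(5) by (auto simp: descent_bundles_def)
qed

lemma descent_bundle_parts:
  assumes "(j, B) \<in> descent_bundles \<pi> P i l"
  shows "outer_part P j B \<subset> P" "b \<in> B \<Longrightarrow> inner_part P j B b \<subset> P"
proof -
  have "j \<in> P" "j \<notin> outer_part P j B" using assms by (auto simp: descent_bundles_def outer_part_def)
  then show "outer_part P j B \<subset> P" by (auto simp: outer_part_def)
  assume "b \<in> B"
  then obtain p where "p \<in> P" "p < b" using assms by (auto simp: descent_bundles_def)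
  then have "p \<notin> inner_part P j B b" by (auto simp: inner_part_def)
  then show "inner_part P j B b \<subset> P" using \<open>p \<in> P\<close> by (auto simp: inner_part_def)
qed

lemma hook_sets_no_required:
  assumes "\<And>l. \<not> required full \<pi> P l"
  shows "hook_sets full \<pi> P = {{}}"
proof -
  have "K = {}" if "K \<in> hook_sets full \<pi> P" for K
    using hook_setsD(8)[OF that] assms by (metis equals0I surj_pair)
  moreover have "{} \<in> hook_sets full \<pi> P" using assms by (auto intro: hook_setsI)
  ultimately show ?thesis by blast
qed

lemma hook_total_no_required:
  assumes "\<And>l. \<not> required full \<pi> P l"
  shows "hook_total full E d \<pi> P = E (card P)"
  using hook_sets_no_required[OF assms] by (simp add: hook_total_def weight_def hit_def)

text \<open>\<open>hook_total_descent\<close> has the same form for all \<open>full\<close> and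
  \<open>E\<close>, so induction carries the agreement assumed on increasing sets to every
  set.\<close>

lemma hook_total_False_eq_True:
  assumes "finite P" "inj_on \<pi> P"
    and "\<And>Q. Q \<subseteq> P \<Longrightarrow> strict_mono_on Q \<pi> \<Longrightarrow> E (card Q) = hook_total True E' d \<pi> Q"
  shows "hook_total False E d \<pi> P = hook_total True E' d \<pi> P"
  using assms
proof (induction P rule: finite_psubset_induct)
  case (psubset P)
  let ?D = "{p. \<exists>l. covers P p l \<and> \<pi> l < \<pi> p}"
  have finD: "finite ?D" by (rule finite_subset[OF _ psubset.hyps(1)]) (auto simp: covers_def)
  show ?case
  proof (cases "?D = {}")
    case True
    then have nr: "\<not> required False \<pi> P l" for l by (auto simp: required_def)
    have "\<pi> x < \<pi> y" if xy: "x \<in> P" "y \<in> P" "x < y" for x y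
    proof (rule ccontr)
      assume "\<not> \<pi> x < \<pi> y"
      then have "\<pi> y < \<pi> x" using inj_onD[OF psubset.prems(1), of x y] xy by force
      then obtain p l where "covers P p l" "\<pi> l < \<pi> p"
        by (metis descent_between[OF psubset.hyps(1) xy])
      then show False using True by blast
    qed
    then have "strict_mono_on P \<pi>" by (auto simp: strict_mono_on_def)
    then show ?thesis using hook_total_no_required[OF nr] psubset.prems(2)[of P] by simp
  next
    case False
    have M: "finite (\<pi> ` ?D)" "\<pi> ` ?D \<noteq> {}" using finD False by auto
    have "Max (\<pi> ` ?D) \<in> \<pi> ` ?D" by (rule Max_in[OF M])
    then obtain i l where i: "covers P i l" "\<pi> l < \<pi> i" "\<pi> i = Max (\<pi> ` ?D)" by auto
    have max: "\<pi> p \<le> \<pi> i" if "covers P p l'" "\<pi> l' < \<pi> p" for p l'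
      using Max_ge[OF M(1)] i(3) that by auto
    have IH: "hook_total False E d \<pi> Q = hook_total True E' d \<pi> Q" if "Q \<subset> P" for Q
      by (rule psubset.IH) (use that psubset.prems in \<open>auto intro: inj_on_subset\<close>)
    have rec: "hook_total full E d \<pi> P = (\<Sum>(j, B)\<in>descent_bundles \<pi> P i l. (d choose card B) *
      (hook_total full E d \<pi> (outer_part P j B) * (\<Prod>b\<in>B. hook_total full E d \<pi> (inner_part P j B b))))"
      for full E
      by (rule hook_total_descent[OF psubset.hyps(1) psubset.prems(1) i(1,2)]) (rule max)
    show ?thesis
      unfolding rec by (intro sum.cong refl) (auto simp: IH descent_bundle_parts)
  qed
qed

section \<open>Recurrence at the root\<close>

definition initial_parts :: "nat set \<Rightarrow> nat set set" where
  "initial_parts Q = {V. V \<subseteq> Q \<and> (\<forall>x\<in>V. \<forall>y\<in>Q. y < x \<longrightarrow> y \<in> V)}"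

text \<open>A splitting into nonempty consecutive blocks is encoded by the minima of the blocks, to
  match the sets \<open>B\<close> of left ends. The empty set has just the empty splitting.\<close>

definition block_starts :: "nat set \<Rightarrow> nat set set" where
  "block_starts Q = {C. C \<subseteq> Q \<and> (Q \<noteq> {} \<longrightarrow> Min Q \<in> C)}"

definition block :: "nat set \<Rightarrow> nat set \<Rightarrow> nat \<Rightarrow> nat set" where
  "block Q C c = {x\<in>Q. c \<le> x \<and> (\<forall>c'\<in>C. c' \<le> x \<longrightarrow> c' \<le> c)}"

text \<open>\<open>C\<close> fixes the nonempty blocks and the binomial the slots that they occupy
  in order. If \<open>F\<close> counts trees, this counts forests of \<open>k\<close> possibly empty
  trees.\<close>

definition forest_total :: "(nat set \<Rightarrow> nat) \<Rightarrow> nat \<Rightarrow> nat set \<Rightarrow> nat" where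
  "forest_total F k Q = (\<Sum>C\<in>block_starts Q. (k choose card C) * (\<Prod>c\<in>C. F (block Q C c)))"

lemma finite_block_starts: "finite Q \<Longrightarrow> finite (block_starts Q)"
  by (rule finite_subset[of _ "Pow Q"]) (auto simp: block_starts_def)

lemma finite_initial_parts: "finite Q \<Longrightarrow> finite (initial_parts Q)"
  by (rule finite_subset[of _ "Pow Q"]) (auto simp: initial_parts_def)

lemma forest_total_empty [simp]: "forest_total F k {} = 1"
proof -
  have "block_starts {} = {{}}" by (auto simp: block_starts_def)
  then show ?thesis by (simp add: forest_total_def)
qed

lemma forest_total_0:
  assumes "finite Q" "Q \<noteq> {}"
  shows "forest_total F 0 Q = 0"
proof -
  have "(0 choose card C) * (\<Prod>c\<in>C. F (block Q C c)) = 0" if "C \<in> block_starts Q" for C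
  proof -
    have "card C \<noteq> 0" using that assms finite_subset[of C Q] by (auto simp: block_starts_def)
    then show ?thesis by (cases "card C") auto
  qed
  then show ?thesis unfolding forest_total_def by (rule sum.neutral[rule_format])
qed

text \<open>Splits off the first block. With \<open>block_starts_join\<close> this is a bijection
  onto pairs of a nonempty initial part and a splitting of the rest.\<close>

lemma block_starts_split:
  assumes fin: "finite Q" and C: "C \<in> block_starts Q" "Q \<noteq> {}"
    and V_def: "V = {x\<in>Q. \<forall>c\<in>C - {Min Q}. x < c}"
  shows "V \<in> initial_parts Q" "Min Q \<in> V" "C - {Min Q} \<in> block_starts (Q - V)"
    "block Q C (Min Q) = V" "c \<in> C - {Min Q} \<Longrightarrow> block (Q - V) (C - {Min Q}) c = block Q C c"
proof -
  have CQ: "C \<subseteq> Q" "Min Q \<in> C" using C by (auto simp: block_starts_def)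
  have Min_le: "Min Q \<le> x" if "x \<in> Q" for x using fin that by simp
  then have Min_less: "Min Q < c" if "c \<in> C - {Min Q}" for c using that CQ by (metis Diff_iff insertCI le_neq_implies_less subsetD)
  show "V \<in> initial_parts Q" unfolding initial_parts_def V_def by (auto intro: less_trans)
  show "Min Q \<in> V" using CQ Min_less by (auto simp: V_def)
  have "Min (Q - V) \<in> C - {Min Q}" if "Q - V \<noteq> {}"
  proof -
    have M: "Min (Q - V) \<in> Q - V" using Min_in[of "Q - V"] fin that by blast
    then obtain c where c: "c \<in> C - {Min Q}" "c \<le> Min (Q - V)" by (auto simp: V_def not_less)
    then have "c \<in> Q - V" using CQ by (auto simp: V_def)
    then have "Min (Q - V) \<le> c" using fin by simp
    then show ?thesis using c by (metis le_antisym)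
  qed
  moreover have "C - {Min Q} \<subseteq> Q - V" using CQ by (auto simp: V_def)
  ultimately show "C - {Min Q} \<in> block_starts (Q - V)" by (auto simp: block_starts_def)
  show "block Q C (Min Q) = V"
  proof (intro equalityI subsetI)
    fix x assume x: "x \<in> block Q C (Min Q)"
    have "x < c" if "c \<in> C - {Min Q}" for c
      using x that Min_less[OF that] by (force simp: block_def)
    then show "x \<in> V" using x by (auto simp: V_def block_def)
  next
    fix x assume "x \<in> V"
    then have "x \<in> Q" "\<And>c. c \<in> C \<Longrightarrow> c \<noteq> Min Q \<Longrightarrow> x < c" by (auto simp: V_def)
    then show "x \<in> block Q C (Min Q)" using Min_le unfolding block_def by (blast dest: leD)
  qed
  assume c: "c \<in> C - {Min Q}"
  have "x \<notin> V" if "c \<le> x" for x using that c unfolding V_def by (blast dest: leD)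
  then show "block (Q - V) (C - {Min Q}) c = block Q C c"
    using less_imp_le[OF Min_less[OF c]] unfolding block_def by blast
qed

lemma block_starts_join:
  assumes fin: "finite Q" and V: "V \<in> initial_parts Q" "V \<noteq> {}" and C: "C \<in> block_starts (Q - V)"
  shows "insert (Min Q) C \<in> block_starts Q" "Min Q \<notin> C" "V = {x\<in>Q. \<forall>c\<in>C. x < c}"
proof -
  have VQ: "V \<subseteq> Q" "\<And>x y. x \<in> V \<Longrightarrow> y \<in> Q \<Longrightarrow> y < x \<Longrightarrow> y \<in> V"
    using V by (auto simp: initial_parts_def)
  have CQ: "C \<subseteq> Q - V" "Q - V \<noteq> {} \<Longrightarrow> Min (Q - V) \<in> C" using C by (auto simp: block_starts_def)
  obtain x where x: "x \<in> V" using V by blast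
  then have "Q \<noteq> {}" using VQ by blast
  then have M: "Min Q \<in> Q" "Min Q \<le> x" using fin x VQ by auto
  then have "Min Q \<in> V" using VQ(2)[OF x M(1)] x by (cases "Min Q = x") auto
  then show "Min Q \<notin> C" using CQ by blast
  show "insert (Min Q) C \<in> block_starts Q" using M CQ by (auto simp: block_starts_def)
  show "V = {x\<in>Q. \<forall>c\<in>C. x < c}"
  proof (intro equalityI subsetI)
    fix x assume x: "x \<in> V"
    have "x < c" if "c \<in> C" for c
      using VQ(2)[OF x, of c] CQ(1) that x by (metis Diff_iff linorder_neqE_nat subsetD)
    then show "x \<in> {x\<in>Q. \<forall>c\<in>C. x < c}" using x VQ by blast
  next
    fix x assume x: "x \<in> {x\<in>Q. \<forall>c\<in>C. x < c}"
    show "x \<in> V"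
    proof (rule ccontr)
      assume "x \<notin> V"
      then have "x \<in> Q - V" using x by simp
      then have "Min (Q - V) \<in> C" "Min (Q - V) \<le> x" using CQ(2) fin by auto
      then show False using x by fastforce
    qed
  qed
qed

text \<open>Pascal's rule for the first slot: it is empty and leaves all blocks to the other
  \<open>k\<close> slots, or it holds the block of \<open>Min Q\<close> and leaves
  \<open>C - {Min Q}\<close>.\<close>

lemma forest_total_Suc:
  assumes fin: "finite Q" and F0: "F {} = 1"
  shows "forest_total F (Suc k) Q = (\<Sum>V\<in>initial_parts Q. F V * forest_total F k (Q - V))"
proof (cases "Q = {}")
  case True
  have "initial_parts {} = {{}}" by (auto simp: initial_parts_def)
  then show ?thesis using True F0 by simp
next
  case False
  let ?m = "Min Q"
  let ?T = "SIGMA V:initial_parts Q - {{}}. block_starts (Q - V)"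
  let ?h = "\<lambda>(V, C). F V * ((k choose card C) * (\<Prod>c\<in>C. F (block (Q - V) C c)))"
  let ?P = "\<lambda>C. \<Prod>c\<in>C. F (block Q C c)"
  let ?V = "\<lambda>C. {x\<in>Q. \<forall>c\<in>C - {?m}. x < c}"
  have "(\<Sum>C\<in>block_starts Q. (k choose card (C - {?m})) * ?P C) = (\<Sum>z\<in>?T. ?h z)"
  proof (rule sum.reindex_bij_witness[of _ "\<lambda>(V, C). insert ?m C" "\<lambda>C. (?V C, C - {?m})"])
    fix C assume C: "C \<in> block_starts Q"
    note split = block_starts_split[OF fin C False refl]
    have mC: "?m \<in> C" and finC: "finite C" using C False fin finite_subset by (auto simp: block_starts_def)
    show "(case (?V C, C - {?m}) of (V, C) \<Rightarrow> insert ?m C) = C" using mC by auto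
    show "(?V C, C - {?m}) \<in> ?T" using split(1-3) by blast
    have "?P C = F (?V C) * (\<Prod>c\<in>C - {?m}. F (block Q C c))"
      using prod.remove[OF finC mC, of "\<lambda>c. F (block Q C c)"] split(4) by simp
    then show "?h (?V C, C - {?m}) = (k choose card (C - {?m})) * ?P C"
      using split(5) by simp
  next
    fix z assume "z \<in> ?T"
    then obtain V C where z: "z = (V, C)" "V \<in> initial_parts Q" "V \<noteq> {}" "C \<in> block_starts (Q - V)" by blast
    note join = block_starts_join[OF fin z(2-4)]
    show "(case z of (V, C) \<Rightarrow> insert ?m C) \<in> block_starts Q" using join z by simp
    show "(?V (case z of (V, C) \<Rightarrow> insert ?m C), (case z of (V, C) \<Rightarrow> insert ?m C) - {?m}) = z"
      using join(2) join(3)[symmetric] z(1) by simp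
  qed
  also have "\<dots> = (\<Sum>V\<in>initial_parts Q - {{}}. F V * forest_total F k (Q - V))"
    using fin finite_initial_parts finite_block_starts
    by (subst sum.Sigma[symmetric]) (auto simp: forest_total_def sum_distrib_left)
  finally have 1: "(\<Sum>C\<in>block_starts Q. (k choose card (C - {?m})) * ?P C) =
      (\<Sum>V\<in>initial_parts Q - {{}}. F V * forest_total F k (Q - V))" .
  have "Suc k choose card C = (k choose card C) + (k choose card (C - {?m}))"
    if "C \<in> block_starts Q" for C
  proof -
    have "?m \<in> C" "finite C" using that False fin finite_subset by (auto simp: block_starts_def)
    then have "card C = Suc (card (C - {?m}))" by (rule card.remove[OF _, rotated])
    then show ?thesis by simp
  qed
  then have "forest_total F (Suc k) Q = (\<Sum>C\<in>block_starts Q.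
      (k choose card C) * ?P C + (k choose card (C - {?m})) * ?P C)"
    by (simp add: forest_total_def add_mult_distrib)
  also have "\<dots> = forest_total F k Q + (\<Sum>V\<in>initial_parts Q - {{}}. F V * forest_total F k (Q - V))"
    unfolding sum.distrib 1 by (simp add: forest_total_def)
  also have "\<dots> = (\<Sum>V\<in>initial_parts Q. F V * forest_total F k (Q - V))"
    using sum.remove[OF finite_initial_parts[OF fin], of "{}" "\<lambda>V. F V * forest_total F k (Q - V)"] F0
    by (simp add: initial_parts_def)
  finally show ?thesis .
qed

text \<open>With \<open>full = True\<close> a hook with left end \<open>Max P\<close> is required as
  soon as \<open>P\<close> has two elements, and it can only end at \<open>Max P\<close>. Nothing
  lies after this endpoint, so the pieces of its bundle, apart from the root alone, are the subtrees
  of its children.\<close>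

lemma hook_total_root:
  assumes fin: "finite P" and ne: "P \<noteq> {}" and inj: "inj_on \<pi> P"
    and r_max: "\<And>x. x \<in> P \<Longrightarrow> \<pi> x \<le> \<pi> (Max P)"
  shows "hook_total True (\<lambda>_. 1) d \<pi> P = forest_total (hook_total True (\<lambda>_. 1) d \<pi>) d (P - {Max P})"
    (is "?F P = forest_total ?F d _")
proof -
  define r where "r = Max P"
  have r: "r \<in> P" "\<And>x. x \<in> P \<Longrightarrow> x \<le> r" using fin ne by (auto simp: r_def)
  have F_single: "?F {r} = 1" by (rule hook_total_no_required) (auto simp: required_def covers_def)
  show ?thesis
  proof (cases "P = {r}")
    case True
    then have "P - {Max P} = {}" by (simp add: r_def[symmetric])
    then show ?thesis using F_single True by simp
  next
    case False
    define m where "m = Min P"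
    define Q where "Q = P - {r}"
    have m: "m \<in> P" "\<And>x. x \<in> P \<Longrightarrow> m \<le> x" using fin ne by (auto simp: m_def)
    have "Q \<noteq> {}" "finite Q" using False r fin by (auto simp: Q_def)
    then obtain y where "y \<in> P" "y \<noteq> r" by (auto simp: Q_def)
    then have "m < r" using m(2)[of y] r(2)[of y] by simp
    then have MinQ: "Min Q = m" using m fin by (intro Min_eqI) (auto simp: Q_def)
    let ?D = "{r} \<times> {B. B \<subseteq> P - {m} \<and> r \<in> B}"
    let ?h = "\<lambda>(j, B). (d choose card B) *
      (?F (outer_part P j B) * (\<Prod>b\<in>B. ?F (inner_part P j B b)))"
    have "?F P = (\<Sum>z\<in>?D. ?h z)"
    proof (rule hook_total_split[OF fin])
      show "finite ?D" using fin by simp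
      fix j B assume "(j, B) \<in> ?D"
      then have jB: "j = r" "B \<subseteq> P - {m}" "r \<in> B" by auto
      have below: "\<pi> x < \<pi> r" if "x \<in> P" "x < r" for x
        using r_max[OF that(1)] that inj_onD[OF inj, of x r] r(1) by (force simp: r_def[symmetric] le_less)
      obtain p where "covers P p r" by (rule covers_exists[OF fin m(1) r(1) \<open>m < r\<close>])
      then have req: "required True \<pi> P r" by (auto simp: required_def)
      have above: "\<not> r < x" if "x \<in> P" for x using r(2)[OF that] by simp
      have "m < b" if "b \<in> B" for b using that jB(2) m(2)[of b] by (auto simp: le_less)
      then have pre: "\<exists>p\<in>P. p < b" if "b \<in> B" for b using that m(1) by blast
      show "hook_bundle True \<pi> P j B"
        unfolding jB(1) using fin inj r jB below above pre req by unfold_locales blast+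
    next
      fix K assume K: "K \<in> hook_sets True \<pi> P"
      note D = hook_setsD[OF K]
      obtain p where "covers P p r" by (rule covers_exists[OF fin m(1) r(1) \<open>m < r\<close>])
      then obtain e where e: "(r, e) \<in> K" using D(6)[of r] by (auto simp: required_def)
      then have "(r, r) \<in> K" using D(2,3) r(2) by (metis le_antisym)
      moreover have "l \<in> P - {m}" if "(l, r) \<in> K" for l
        using D(1,4)[OF that] m(2) by (force simp: covers_def)
      ultimately show "\<exists>j. (j, {l. (l, j) \<in> K}) \<in> ?D" by blast
      show "j = j'" if "(j, {l. (l, j) \<in> K}) \<in> ?D" "(j', {l. (l, j') \<in> K}) \<in> ?D" for j j'
        using that by simp
    qed
    also have "\<dots> = (\<Sum>C\<in>block_starts Q. (d choose card C) * (\<Prod>c\<in>C. ?F (block Q C c)))"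
    \<comment> \<open>The pieces start at \<open>m\<close> (the outer one), at the elements of
      \<open>B - {r}\<close>, and at \<open>r\<close>. The last is {r} and has total 1, so
      exchanging \<open>r\<close> for \<open>m\<close> gives the block starts of \<open>Q\<close>
      without changing the cardinality.\<close>
    proof (rule sum.reindex_bij_witness[of _ "\<lambda>C. (r, insert r (C - {m}))" "\<lambda>(j, B). insert m (B - {r})"])
      fix C assume "C \<in> block_starts Q"
      then have C: "C \<subseteq> P - {r}" "m \<in> C" using \<open>Q \<noteq> {}\<close> MinQ by (auto simp: block_starts_def Q_def)
      show "(case (r, insert r (C - {m})) of (j, B) \<Rightarrow> insert m (B - {r})) = C"
        using C by auto
      show "(r, insert r (C - {m})) \<in> ?D" using C r \<open>m < r\<close> by auto
    next
      fix z assume "z \<in> ?D"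
      then obtain B where z: "z = (r, B)" and B: "B \<subseteq> P - {m}" "r \<in> B" by auto
      let ?C = "insert m (B - {r})"
      have finB: "finite B" using B fin finite_subset by blast
      show "(r, insert r ((case z of (j, B) \<Rightarrow> insert m (B - {r})) - {m})) = z"
        using B z \<open>m < r\<close> by auto
      show "(case z of (j, B) \<Rightarrow> insert m (B - {r})) \<in> block_starts Q"
        using B z m \<open>m < r\<close> MinQ by (auto simp: block_starts_def Q_def)
      have c: "card ?C = card B"
      proof -
        have "m \<notin> B - {r}" using B by blast
        then have "card ?C = Suc (card (B - {r}))" using finB by simp
        also have "\<dots> = card B" using card.remove[OF finB B(2)] by simp
        finally show ?thesis .
      qed
      have m_less: "m < b" if "b \<in> B" for b using that B m(2)[of b] by (auto simp: le_less)
      have outer: "outer_part P r B = block Q ?C m"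
      proof (intro equalityI subsetI)
        fix x assume x: "x \<in> outer_part P r B"
        then have "x \<in> P" "\<forall>b\<in>B. x < b" using r(2)[of x] by (auto simp: outer_part_def)
        then show "x \<in> block Q ?C m" using B(2) m(2) by (force simp: block_def Q_def)
      next
        fix x assume x: "x \<in> block Q ?C m"
        have "x < b" if "b \<in> B" for b
        proof (cases "b = r")
          case True
          then show ?thesis using x r(2)[of x] by (auto simp: block_def Q_def le_less)
        next
          case False
          then have "b \<le> x \<longrightarrow> b \<le> m" using x that by (simp add: block_def)
          then show ?thesis using m_less[OF that] by simp
        qed
        then show "x \<in> outer_part P r B" using x by (auto simp: outer_part_def block_def Q_def)
      qed
      have inner: "inner_part P r B b = block Q ?C b" if b: "b \<in> B - {r}" for b
      proof (intro equalityI subsetI)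
        have "b < r" using b B r(2)[of b] by (auto simp: le_less)
        fix x assume x: "x \<in> inner_part P r B b"
        then have "x \<noteq> r" using \<open>b < r\<close> B(2) by (auto simp: inner_part_def)
        then show "x \<in> block Q ?C b"
          using x less_imp_le[OF m_less[of b]] b by (auto simp: inner_part_def block_def Q_def)
      next
        fix x assume x: "x \<in> block Q ?C b"
        then have "x \<in> P" "x \<noteq> r" by (auto simp: block_def Q_def)
        then have "x < r" using r(2)[of x] by simp
        then show "x \<in> inner_part P r B b" using x by (auto simp: inner_part_def block_def Q_def)
      qed
      have last: "inner_part P r B r = {r}" using r B(1) by (auto simp: inner_part_def)
      have "(\<Prod>b\<in>B. ?F (inner_part P r B b)) = (\<Prod>b\<in>B - {r}. ?F (block Q ?C b))"
        using prod.remove[OF finB B(2), of "\<lambda>b. ?F (inner_part P r B b)"] last F_single inner by simp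
      moreover have "m \<notin> B - {r}" using B by blast
      ultimately have "(d choose card ?C) * (\<Prod>c\<in>?C. ?F (block Q ?C c)) = ?h (r, B)"
        using outer c finB by simp
      then show "(d choose card (case z of (j, B) \<Rightarrow> insert m (B - {r}))) *
          (\<Prod>c\<in>(case z of (j, B) \<Rightarrow> insert m (B - {r})).
            ?F (block Q (case z of (j, B) \<Rightarrow> insert m (B - {r})) c)) = ?h z"
        using z by simp
    qed
    finally show ?thesis by (simp add: forest_total_def Q_def r_def)
  qed
qed

text \<open>The position of the largest label is not the last one, so it requires a hook, whose
  endpoint would have to be still higher.\<close>

lemma hook_total_root_zero:
  assumes fin: "finite P" and x: "x \<in> P" "\<pi> (Max P) < \<pi> x"
  shows "hook_total True E d \<pi> P = 0"
proof -
  have "Max (\<pi> ` P) \<in> \<pi> ` P" using fin x by (intro Max_in) auto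
  then obtain y where y: "y \<in> P" "\<pi> y = Max (\<pi> ` P)" by auto
  have y_max: "\<pi> z \<le> \<pi> y" if "z \<in> P" for z using fin that y(2) by simp
  have "Max P \<in> P" using fin x by (intro Max_in) auto
  moreover have "y \<le> Max P" using fin y by simp
  moreover have "y \<noteq> Max P" using y_max[OF x(1)] x by auto
  ultimately obtain l where l: "covers P y l"
    using covers_succ_exists[OF fin y(1)] by (metis le_neq_implies_less)
  have "K \<notin> hook_sets True \<pi> P" for K
  proof
    assume K: "K \<in> hook_sets True \<pi> P"
    note D = hook_setsD[OF K]
    obtain e where e: "(l, e) \<in> K" using D(6)[of l] l by (auto simp: required_def)
    obtain p where "covers P p l" "\<pi> p < \<pi> e" using D(4)[OF e] by blast
    then show False using covers_unique[OF l] y_max[OF D(2)[OF e]] by auto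
  qed
  then have "hook_sets True \<pi> P = {}" by blast
  then show ?thesis by (simp add: hook_total_def)
qed

section \<open>Decreasing trees with given postorder\<close>

definition postorder_trees :: "nat \<Rightarrow> (nat \<Rightarrow> nat) \<Rightarrow> nat set \<Rightarrow> nat ptree set" where
  "postorder_trees d \<pi> Q =
     {t. dary d t \<and> decreasing t \<and> postorder t = map \<pi> (sorted_list_of_set Q)}"

definition postorder_forests :: "nat \<Rightarrow> (nat \<Rightarrow> nat) \<Rightarrow> nat \<Rightarrow> nat set \<Rightarrow> nat ptree list set" where
  "postorder_forests d \<pi> k Q =
     {ts. length ts = k \<and> (\<forall>t\<in>set ts. dary d t \<and> decreasing t) \<and>
       concat (map postorder ts) = map \<pi> (sorted_list_of_set Q)}"

lemma sorted_list_of_set_initial: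
  assumes "finite Q" "V \<in> initial_parts Q"
  shows "sorted_list_of_set Q = sorted_list_of_set V @ sorted_list_of_set (Q - V)"
proof -
  have V: "V \<subseteq> Q" "finite V" using assms finite_subset by (auto simp: initial_parts_def)
  have "x < y" if "x \<in> V" "y \<in> Q - V" for x y
    using assms(2) that by (auto simp: initial_parts_def) (metis linorder_neqE_nat)
  then have "sorted_wrt (<) (sorted_list_of_set V @ sorted_list_of_set (Q - V))"
    using V assms(1) by (simp add: sorted_wrt_append)
  moreover have "set (sorted_list_of_set V @ sorted_list_of_set (Q - V)) = Q"
    using V assms(1) by auto
  ultimately show ?thesis
    using assms(1) by (intro strict_sorted_equal) auto
qed

lemma sorted_list_of_set_appendD:
  assumes "finite Q" "sorted_list_of_set Q = xs @ ys"
  shows "set xs \<in> initial_parts Q" "xs = sorted_list_of_set (set xs)"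
    "ys = sorted_list_of_set (Q - set xs)"
proof -
  have s: "sorted_wrt (<) (xs @ ys)" using assms(2) by (metis strict_sorted_list_of_set)
  have Q: "Q = set xs \<union> set ys" using assms by (metis set_append set_sorted_list_of_set)
  have less: "x < y" if "x \<in> set xs" "y \<in> set ys" for x y using s that by (simp add: sorted_wrt_append)
  show "set xs \<in> initial_parts Q" using Q less by (force simp: initial_parts_def)
  have sx: "sorted_wrt (<) xs" "sorted_wrt (<) ys" using s by (auto simp: sorted_wrt_append)
  then show "xs = sorted_list_of_set (set xs)" by (intro strict_sorted_equal) auto
  have "Q - set xs = set ys" using Q less by force
  then show "ys = sorted_list_of_set (Q - set xs)" using sx by (intro strict_sorted_equal) auto
qed

text \<open>\<open>decreasing\<close> compares a root with its children; the form with all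
  descendants can be read off the postorder word.\<close>

lemma decreasing_Node_iff:
  "decreasing (Node x ts) \<longleftrightarrow>
    (\<forall>t\<in>set ts. decreasing t) \<and> (\<forall>y\<in>set (concat (map postorder ts)). y < x)"
proof -
  have le: "y \<le> z" if "decreasing t" "t = Node z us" "y \<in> set (postorder t)" for t z us y
    using that
  proof (induction t arbitrary: y z us)
    case (Node x ts)
    show ?case
    proof (cases "y = x")
      case False
      then obtain t where t: "t \<in> set ts" "y \<in> set (postorder t)" using Node.prems by auto
      obtain z' us' where z': "t = Node z' us'" using t(2) by (cases t) auto
      have "y \<le> z'" using Node.IH[OF t(1) _ z' t(2)] Node.prems(1) t(1) by auto
      also have "z' < x" using Node.prems(1) t(1) z' by auto
      finally show ?thesis using Node.prems by simp
    qed (use Node.prems in simp)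
  qed simp
  show ?thesis
  proof
    assume d: "decreasing (Node x ts)"
    have "y < x" if ty: "t \<in> set ts" "y \<in> set (postorder t)" for t y
    proof -
      obtain z us where z: "t = Node z us" using ty(2) by (cases t) auto
      then have "y \<le> z" using le[OF _ z ty(2)] d ty(1) by auto
      also have "z < x" using d ty(1) z by auto
      finally show ?thesis .
    qed
    then show "(\<forall>t\<in>set ts. decreasing t) \<and> (\<forall>y\<in>set (concat (map postorder ts)). y < x)"
      using d by auto
  next
    assume d: "(\<forall>t\<in>set ts. decreasing t) \<and> (\<forall>y\<in>set (concat (map postorder ts)). y < x)"
    have "y < x" if "Node y us \<in> set ts" for y us
      using d that by force
    then show "decreasing (Node x ts)" using d by auto
  qed
qed

lemma postorder_trees_empty: "postorder_trees d \<pi> {} = {Empty}"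
proof -
  have "t = Empty" if "postorder t = []" for t :: "nat ptree" using that by (cases t) auto
  then show ?thesis by (auto simp: postorder_trees_def)
qed

lemma postorder_trees_nonempty:
  assumes fin: "finite P" and ne: "P \<noteq> {}"
  shows "postorder_trees d \<pi> P =
    (if \<forall>x\<in>P - {Max P}. \<pi> x < \<pi> (Max P)
     then Node (\<pi> (Max P)) ` postorder_forests d \<pi> d (P - {Max P}) else {})"
proof -
  let ?r = "Max P" and ?Q = "P - {Max P}"
  have r: "?r \<in> P" "\<And>x. x \<in> P \<Longrightarrow> x \<le> ?r" using fin ne by auto
  have "?Q \<in> initial_parts P" using r(2) by (force simp: initial_parts_def)
  moreover have "P - ?Q = {?r}" using r by auto
  ultimately have s: "map \<pi> (sorted_list_of_set P) = map \<pi> (sorted_list_of_set ?Q) @ [\<pi> ?r]"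
    using sorted_list_of_set_initial[OF fin] by simp
  have "t \<in> postorder_trees d \<pi> P \<longleftrightarrow> (\<exists>ts. t = Node (\<pi> ?r) ts \<and> ts \<in> postorder_forests d \<pi> d ?Q
      \<and> (\<forall>x\<in>?Q. \<pi> x < \<pi> ?r))" for t
  proof (cases t)
    case Empty
    then show ?thesis using s by (simp add: postorder_trees_def)
  next
    case (Node x ts)
    show ?thesis
    proof (cases "x = \<pi> ?r \<and> concat (map postorder ts) = map \<pi> (sorted_list_of_set ?Q)")
      case True
      then have "set (concat (map postorder ts)) = \<pi> ` ?Q" using fin by simp
      then have "decreasing (Node x ts) \<longleftrightarrow> (\<forall>t\<in>set ts. decreasing t) \<and> (\<forall>y\<in>?Q. \<pi> y < \<pi> ?r)"
        unfolding decreasing_Node_iff using True by simp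
      then show ?thesis
        using True s Node by (auto simp: postorder_trees_def postorder_forests_def simp del: decreasing.simps)
    next
      case False
      then show ?thesis using s Node by (auto simp: postorder_trees_def postorder_forests_def)
    qed
  qed
  then show ?thesis by auto
qed

lemma postorder_forests_0: "postorder_forests d \<pi> 0 Q = (if finite Q \<and> Q \<noteq> {} then {} else {[]})"
  by (auto simp: postorder_forests_def)

text \<open>The word is cut after the word of the first tree, whose positions therefore form an
  initial part, possibly empty.\<close>

lemma postorder_forests_Suc:
  assumes fin: "finite Q"
  shows "postorder_forests d \<pi> (Suc k) Q = (\<lambda>(t, ts). t # ts) `
    (\<Union>V\<in>initial_parts Q. postorder_trees d \<pi> V \<times> postorder_forests d \<pi> k (Q - V))"
proof (intro equalityI subsetI)
  fix us assume us: "us \<in> postorder_forests d \<pi> (Suc k) Q"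
  then obtain t ts where [simp]: "us = t # ts" by (cases us) (auto simp: postorder_forests_def)
  have "map \<pi> (sorted_list_of_set Q) = postorder t @ concat (map postorder ts)"
    using us by (simp add: postorder_forests_def)
  then obtain xs ys where xy: "sorted_list_of_set Q = xs @ ys" "map \<pi> xs = postorder t"
    "map \<pi> ys = concat (map postorder ts)" by (auto simp: map_eq_append_conv)
  note D = sorted_list_of_set_appendD[OF fin xy(1)]
  have "t \<in> postorder_trees d \<pi> (set xs)" "ts \<in> postorder_forests d \<pi> k (Q - set xs)"
    using us xy(2,3) D(2,3) by (auto simp: postorder_trees_def postorder_forests_def)
  then show "us \<in> (\<lambda>(t, ts). t # ts) `
    (\<Union>V\<in>initial_parts Q. postorder_trees d \<pi> V \<times> postorder_forests d \<pi> k (Q - V))"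
    using D(1) by force
next
  fix us assume "us \<in> (\<lambda>(t, ts). t # ts) `
    (\<Union>V\<in>initial_parts Q. postorder_trees d \<pi> V \<times> postorder_forests d \<pi> k (Q - V))"
  then obtain V t ts where V: "V \<in> initial_parts Q" "us = t # ts"
    "t \<in> postorder_trees d \<pi> V" "ts \<in> postorder_forests d \<pi> k (Q - V)" by auto
  then show "us \<in> postorder_forests d \<pi> (Suc k) Q"
    using sorted_list_of_set_initial[OF fin V(1)]
    by (auto simp: postorder_forests_def postorder_trees_def)
qed

lemma card_postorder_forests:
  assumes "finite Q" "inj_on \<pi> Q" "F {} = 1"
    and "\<And>V. V \<subseteq> Q \<Longrightarrow> finite (postorder_trees d \<pi> V) \<and> card (postorder_trees d \<pi> V) = F V"
  shows "finite (postorder_forests d \<pi> k Q) \<and> card (postorder_forests d \<pi> k Q) = forest_total F k Q"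
  using assms(1,2,4)
proof (induction k arbitrary: Q)
  case 0
  then show ?case by (simp add: postorder_forests_0 forest_total_0)
next
  case (Suc k)
  let ?S = "\<lambda>V. postorder_trees d \<pi> V \<times> postorder_forests d \<pi> k (Q - V)"
  have IH: "finite (postorder_forests d \<pi> k (Q - V)) \<and>
      card (postorder_forests d \<pi> k (Q - V)) = forest_total F k (Q - V)" for V
    using Suc.prems by (intro Suc.IH) (auto intro: inj_on_subset)
  have S: "finite (?S V)" "card (?S V) = F V * forest_total F k (Q - V)" if "V \<in> initial_parts Q" for V
    using IH[of V] Suc.prems(3)[of V] that by (auto simp: initial_parts_def card_cartesian_product)
  \<comment> \<open>As \<pi> is injective, the labels of the first tree determine its positions, so
    the sets \<open>?S V\<close> are disjoint.\<close>
  have "V = V'" if "V \<in> initial_parts Q" "V' \<in> initial_parts Q" "z \<in> ?S V" "z \<in> ?S V'" for V V' z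
  proof -
    have sub: "V \<subseteq> Q" "V' \<subseteq> Q" using that by (auto simp: initial_parts_def)
    then have fin: "finite V" "finite V'" using Suc.prems(1) finite_subset by auto
    have "map \<pi> (sorted_list_of_set V) = map \<pi> (sorted_list_of_set V')"
      using that(3,4) by (auto simp: postorder_trees_def)
    then have "set (map \<pi> (sorted_list_of_set V)) = set (map \<pi> (sorted_list_of_set V'))" by simp
    then have "\<pi> ` V = \<pi> ` V'" using fin by simp
    then show ?thesis using inj_on_image_eq_iff[OF Suc.prems(2) sub] by simp
  qed
  then have disj: "\<forall>V\<in>initial_parts Q. \<forall>V'\<in>initial_parts Q. V \<noteq> V' \<longrightarrow> ?S V \<inter> ?S V' = {}" by blast
  have fin: "finite (initial_parts Q)" using finite_initial_parts Suc.prems(1) .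
  have "card (postorder_forests d \<pi> (Suc k) Q) = card (\<Union>V\<in>initial_parts Q. ?S V)"
    unfolding postorder_forests_Suc[OF Suc.prems(1)] by (intro card_image) (auto simp: inj_on_def)
  also have "\<dots> = (\<Sum>V\<in>initial_parts Q. card (?S V))"
    using S(1) disj by (intro card_UN_disjoint[OF fin]) auto
  also have "\<dots> = forest_total F (Suc k) Q"
    using forest_total_Suc[of Q F k, OF Suc.prems(1) assms(3)] S(2) by simp
  finally show ?case
    using S(1) fin unfolding postorder_forests_Suc[OF Suc.prems(1)] by blast
qed

lemma card_postorder_trees:
  assumes "finite P" "inj_on \<pi> P"
  shows "finite (postorder_trees d \<pi> P) \<and> card (postorder_trees d \<pi> P) = hook_total True (\<lambda>_. 1) d \<pi> P"
  using assms
proof (induction P rule: finite_psubset_induct)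
  case (psubset P)
  let ?F = "hook_total True (\<lambda>_. 1) d \<pi>"
  have F0: "?F {} = 1" by (rule hook_total_no_required) (auto simp: required_def covers_def)
  show ?case
  proof (cases "P = {}")
    case True
    then show ?thesis using F0 by (simp add: postorder_trees_empty)
  next
    case False
    let ?r = "Max P" and ?Q = "P - {Max P}"
    have r: "?r \<in> P" using psubset.hyps False by simp
    have Q: "finite (postorder_forests d \<pi> d ?Q) \<and> card (postorder_forests d \<pi> d ?Q) = forest_total ?F d ?Q"
    proof (rule card_postorder_forests)
      fix V assume "V \<subseteq> ?Q"
      then have "V \<subset> P" using r by blast
      then show "finite (postorder_trees d \<pi> V) \<and> card (postorder_trees d \<pi> V) = ?F V"
        using psubset.IH psubset.prems inj_on_subset by blast
    qed (use psubset F0 in \<open>auto intro: inj_on_subset\<close>)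
    show ?thesis
    proof (cases "\<forall>x\<in>?Q. \<pi> x < \<pi> ?r")
      case True
      then have "?F P = forest_total ?F d ?Q"
        using psubset False by (intro hook_total_root) (auto simp: le_less)
      moreover have "card (Node (\<pi> ?r) ` postorder_forests d \<pi> d ?Q) = card (postorder_forests d \<pi> d ?Q)"
        by (intro card_image) (auto simp: inj_on_def)
      ultimately show ?thesis
        using True Q postorder_trees_nonempty[OF psubset.hyps False, of d \<pi>] by simp
    next
      case False
      then obtain x where x: "x \<in> ?Q" "\<not> \<pi> x < \<pi> ?r" by blast
      then have "\<pi> ?r < \<pi> x" using inj_onD[OF psubset.prems, of x ?r] r by force
      then have "?F P = 0" using hook_total_root_zero[OF psubset.hyps] x by blast
      then show ?thesis
        using False postorder_trees_nonempty[OF psubset.hyps \<open>P \<noteq> {}\<close>, of d \<pi>] by auto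
    qed
  qed
qed

section \<open>One labeling for each shape when the word increases\<close>

lemma length_postorder: "length (postorder t) = num_vertices t"
  by (induction t) (auto simp: length_concat intro!: arg_cong[where f = sum_list])

lemma set_postorder: "set (postorder t) = set_ptree t"
  by (induction t) auto

text \<open>Trees with the same image have subtrees of the same sizes, so equal words are cut at the
  same places. For constant \<open>f\<close> the image is the shape.\<close>

lemma map_ptree_postorder_inj:
  "map_ptree f s = map_ptree f t \<Longrightarrow> postorder s = postorder t \<Longrightarrow> s = t"
proof (induction s arbitrary: t)
  case Empty
  then show ?case by (cases t) auto
next
  case (Node x ss)
  then obtain y ts where t: "t = Node y ts" by (cases t) auto
  have m: "map (map_ptree f) ss = map (map_ptree f) ts" using Node.prems t by simp
  have p: "concat (map postorder ss) = concat (map postorder ts)" "x = y" using Node.prems t by auto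
  have "ss = ts" using m p(1) Node.IH
  proof (induction ss ts rule: list_induct2')
    case (4 s ss t ts)
    have st: "map_ptree f s = map_ptree f t" using 4 by simp
    have "num_vertices u = num_vertices (map_ptree f u)" for u
      by (induction u) (auto intro!: arg_cong[where f = sum_list])
    then have "length (postorder s) = length (postorder t)" using st by (metis length_postorder)
    then have "postorder s = postorder t" "concat (map postorder ss) = concat (map postorder ts)"
      using 4 by auto
    then show ?case using 4 st by auto
  qed auto
  then show ?case using p t by simp
qed

lemma relabel_exists:
  "length w = num_vertices t \<Longrightarrow> \<exists>s. map_ptree (\<lambda>_. ()) s = t \<and> postorder s = w"
proof (induction t arbitrary: w)
  case Empty
  then show ?case by (intro exI[of _ Empty]) simp
next
  case (Node x ts)
  obtain v y where w: "w = v @ [y]" "length v = sum_list (map num_vertices ts)"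
    using Node.prems by (cases w rule: rev_cases) auto
  have "\<exists>ss. map (map_ptree (\<lambda>_. ())) ss = ts \<and> concat (map postorder ss) = v"
    using w(2) Node.IH
  proof (induction ts arbitrary: v)
    case (Cons t ts)
    have "length (take (num_vertices t) v) = num_vertices t" using Cons.prems(1) by simp
    then obtain s where s: "map_ptree (\<lambda>_. ()) s = t" "postorder s = take (num_vertices t) v"
      using Cons.prems(2)[of t "take (num_vertices t) v"] by (metis list.set_intros(1))
    obtain ss where ss: "map (map_ptree (\<lambda>_. ())) ss = ts"
      "concat (map postorder ss) = drop (num_vertices t) v"
      using Cons.IH[of "drop (num_vertices t) v"] Cons.prems by auto
    show ?case by (rule exI[of _ "s # ss"]) (simp add: s ss)
  qed simp
  then obtain ss where "map (map_ptree (\<lambda>_. ())) ss = ts" "concat (map postorder ss) = v" by blast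
  then show ?case using w(1) by (intro exI[of _ "Node y ss"]) simp
qed

lemma dary_map_ptree: "dary d (map_ptree f t) \<longleftrightarrow> dary d t"
  by (induction t) auto

lemma num_vertices_map_ptree: "num_vertices (map_ptree f t) = num_vertices t"
  by (induction t) (auto intro!: arg_cong[where f = sum_list])

text \<open>In postorder every vertex comes after its descendants, so an increasing word puts no
  constraint on the shape.\<close>

lemma decreasing_if_sorted: "sorted_wrt (<) (postorder t) \<Longrightarrow> decreasing t"
proof (induction t)
  case (Node x ts)
  have "sorted_wrt (<) (postorder t)" if t: "t \<in> set ts" for t
  proof -
    obtain us vs where "ts = us @ t # vs" using split_list[OF t] by blast
    then show ?thesis using Node.prems by (simp add: sorted_wrt_append)
  qed
  then show ?case
    unfolding decreasing_Node_iff using Node by (simp add: sorted_wrt_append)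
qed simp

lemma card_postorder_trees_increasing:
  assumes "finite Q" "strict_mono_on Q \<pi>"
  shows "card (postorder_trees d \<pi> Q) = num_dary_trees d (card Q)"
proof -
  let ?w = "map \<pi> (sorted_list_of_set Q)"
  have "sorted_wrt (\<lambda>x y. \<pi> x < \<pi> y) (sorted_list_of_set Q)"
    by (rule sorted_wrt_mono_rel[of _ "(<)"])
       (use assms strict_sorted_list_of_set in \<open>auto simp: strict_mono_on_def\<close>)
  then have w: "sorted_wrt (<) ?w" by (simp add: sorted_wrt_map)
  have "bij_betw (map_ptree (\<lambda>_. ())) (postorder_trees d \<pi> Q) {t. dary d t \<and> num_vertices t = card Q}"
  proof (intro bij_betw_imageI equalityI subsetI)
    show "inj_on (map_ptree (\<lambda>_. ())) (postorder_trees d \<pi> Q)"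
      by (rule inj_onI, erule map_ptree_postorder_inj) (simp add: postorder_trees_def)
  next
    fix t assume "t \<in> map_ptree (\<lambda>_. ()) ` postorder_trees d \<pi> Q"
    then obtain s where s: "t = map_ptree (\<lambda>_. ()) s" "dary d s" "postorder s = ?w"
      by (auto simp: postorder_trees_def)
    then show "t \<in> {t. dary d t \<and> num_vertices t = card Q}"
      using length_postorder[of s] by (simp add: dary_map_ptree num_vertices_map_ptree)
  next
    fix t :: "unit ptree" assume t: "t \<in> {t. dary d t \<and> num_vertices t = card Q}"
    then obtain s where s: "map_ptree (\<lambda>_. ()) s = t" "postorder s = ?w"
      using relabel_exists[of ?w t] by auto
    then have "s \<in> postorder_trees d \<pi> Q"
      using t w decreasing_if_sorted[of s] dary_map_ptree[of d "\<lambda>_. ()" s] by (simp add: postorder_trees_def)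
    then show "t \<in> map_ptree (\<lambda>_. ()) ` postorder_trees d \<pi> Q" using s by blast
  qed
  then show ?thesis unfolding num_dary_trees_def by (rule bij_betw_same_card)
qed

lemma card_postorder_trees_eq_hook_total:
  assumes "finite P" "inj_on \<pi> P"
  shows "card (postorder_trees d \<pi> P) = hook_total False (num_dary_trees d) d \<pi> P"
proof -
  have "num_dary_trees d (card Q) = hook_total True (\<lambda>_. 1) d \<pi> Q" if "Q \<subseteq> P" "strict_mono_on Q \<pi>" for Q
  proof -
    have "finite Q" "inj_on \<pi> Q" using that assms finite_subset inj_on_subset by auto
    then show ?thesis using card_postorder_trees card_postorder_trees_increasing[of Q \<pi> d] that by metis
  qed
  then show ?thesis
    using card_postorder_trees[OF assms, of d] hook_total_False_eq_True[OF assms, of "num_dary_trees d" "\<lambda>_. 1" d]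
    by simp
qed

section \<open>Hook configurations of permutations\<close>

abbreviation shift_hook :: "hook \<Rightarrow> nat \<times> nat" where
  "shift_hook h \<equiv> (Suc (sw h), ne h)"

lemma covers_atLeastAtMost: "covers {1..n} p l \<longleftrightarrow> 1 \<le> p \<and> l \<le> n \<and> l = Suc p"
proof
  assume c: "covers {1..n} p l"
  then have "Suc p \<in> {1..n} \<longrightarrow> \<not> Suc p < l" unfolding covers_def by (metis lessI)
  then show "1 \<le> p \<and> l \<le> n \<and> l = Suc p" using c by (auto simp: covers_def)
qed (auto simp: covers_def)

lemma required_atLeastAtMost: "required False \<pi> {1..n} l \<longleftrightarrow> (\<exists>i\<in>descents n \<pi>. l = Suc i)"
  unfolding required_def covers_atLeastAtMost descents_def by auto

text \<open>The witnesses are the larger left end and the smaller right end. For encoded left ends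
  \<open>Suc (sw h)\<close> the strict inequalities turn into the weak ones of
  \<open>hook_sets\<close>.\<close>

lemma span_overlap_iff:
  assumes "sw h < ne h" "sw h' < ne h'"
  shows "(\<exists>x y. x \<noteq> y \<and> x \<in> span h \<inter> span h' \<and> y \<in> span h \<inter> span h') \<longleftrightarrow>
    sw h < ne h' \<and> sw h' < ne h"
proof
  assume "\<exists>x y. x \<noteq> y \<and> x \<in> span h \<inter> span h' \<and> y \<in> span h \<inter> span h'"
  then obtain x y where "x \<noteq> y" "x \<in> span h \<inter> span h'" "y \<in> span h \<inter> span h'" by blast
  then show "sw h < ne h' \<and> sw h' < ne h" by (auto simp: span_def)
next
  assume "sw h < ne h' \<and> sw h' < ne h"
  then show "\<exists>x y. x \<noteq> y \<and> x \<in> span h \<inter> span h' \<and> y \<in> span h \<inter> span h'"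
    using assms
    by (intro exI[of _ "real (max (sw h) (sw h'))"] exI[of _ "real (min (ne h) (ne h'))"])
       (auto simp: span_def max_def min_def)
qed

lemma span_subset_iff: "sw h < ne h \<Longrightarrow> span h \<subseteq> span h' \<longleftrightarrow> sw h' \<le> sw h \<and> ne h \<le> ne h'"
  by (auto simp: span_def)

lemma shift_hook_mem: "(l, e) \<in> shift_hook ` S \<longleftrightarrow> (\<exists>i. l = Suc i \<and> (i, e) \<in> S)"
  by force

lemma valid_hook_configs_iff:
  "\<H> \<in> valid_hook_configs n \<pi> \<longleftrightarrow>
    sorted_wrt (<) (map sw \<H>) \<and> shift_hook ` set \<H> \<in> hook_sets False \<pi> {1..n}"
proof -
  let ?K = "shift_hook ` set \<H>"
  \<comment> \<open>Strictly increasing left ends are distinct, which is the clause of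
    \<open>hook_sets\<close> that allows one hook per left end.\<close>
  have uniq: "e = e'" if "sorted_wrt (<) (map sw \<H>)" "(i, e) \<in> set \<H>" "(i, e') \<in> set \<H>" for i e e'
  proof -
    have "distinct (map sw \<H>)" using that(1) strict_sorted_iff by blast
    then show ?thesis using that(2,3) by (metis eq_key_imp_eq_value)
  qed
  have ex: "(\<exists>p. covers {1..n} p (Suc i) \<and> \<pi> p < \<pi> e) \<longleftrightarrow> 1 \<le> i \<and> Suc i \<le> n \<and> \<pi> i < \<pi> e" for i e
    unfolding covers_atLeastAtMost by auto
  show ?thesis
  proof
    assume v: "\<H> \<in> valid_hook_configs n \<pi>"
    then have hook: "1 \<le> i" "i < e" "e \<le> n" "\<pi> i < \<pi> e" if "(i, e) \<in> set \<H>" for i e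
      using that by (auto simp: valid_hook_configs_def is_hook_def)
    have sorted: "sorted_wrt (<) (map sw \<H>)" using v by (simp add: valid_hook_configs_def)
    have desc: "\<exists>e. (i, e) \<in> set \<H>" if "i \<in> descents n \<pi>" for i
      using v that by (force simp: valid_hook_configs_def)
    have ne: "(\<exists>i'\<in>descents n \<pi>. (i', e) \<in> set \<H>) \<and> (e - 1, e) \<in> set \<H>" if "(i, e) \<in> set \<H>" for i e
      using v that unfolding valid_hook_configs_def by fastforce
    have nest: "i' \<le> i \<and> e \<le> e'"
      if "(i, e) \<in> set \<H>" "(i', e') \<in> set \<H>" "\<pi> e < \<pi> e'" "i < e'" "i' < e" for i e i' e'
    proof -
      have "span (i, e) \<subseteq> span (i', e')"
        using v that span_overlap_iff[of "(i, e)" "(i', e')"] hook(2)[OF that(1)] hook(2)[OF that(2)]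
        unfolding valid_hook_configs_def by fastforce
      then show ?thesis using hook(2)[OF that(1)] by (simp add: span_subset_iff)
    qed
    have "?K \<in> hook_sets False \<pi> {1..n}"
    proof (rule hook_setsI)
      fix l e assume "(l, e) \<in> ?K"
      then obtain i where i: "l = Suc i" "(i, e) \<in> set \<H>" by (auto simp: shift_hook_mem)
      note h = hook[OF i(2)]
      show "l \<in> {1..n}" "e \<in> {1..n}" "l \<le> e" using i h by auto
      show "\<exists>p. covers {1..n} p l \<and> \<pi> p < \<pi> e" unfolding i(1) ex using h by simp
      show "(e, e) \<in> ?K" using ne[OF i(2)] h by (auto simp: shift_hook_mem intro!: exI[of _ "e - 1"])
      show "\<exists>l'. required False \<pi> {1..n} l' \<and> (l', e) \<in> ?K"
        using ne[OF i(2)] unfolding required_atLeastAtMost shift_hook_mem by blast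
    next
      fix l assume "required False \<pi> {1..n} l"
      then show "\<exists>e. (l, e) \<in> ?K" using desc unfolding required_atLeastAtMost shift_hook_mem by blast
    next
      fix l e e' assume "(l, e) \<in> ?K" "(l, e') \<in> ?K"
      then show "e = e'" using uniq[OF sorted] by (auto simp: shift_hook_mem)
    next
      fix l e l' e' assume "(l, e) \<in> ?K" "(l', e') \<in> ?K" "\<pi> e < \<pi> e'" "l \<le> e'" "l' \<le> e"
      then show "l' \<le> l \<and> e \<le> e'" using nest by (fastforce simp: shift_hook_mem)
    qed
    then show "sorted_wrt (<) (map sw \<H>) \<and> ?K \<in> hook_sets False \<pi> {1..n}" using sorted by blast
  next
    assume a: "sorted_wrt (<) (map sw \<H>) \<and> ?K \<in> hook_sets False \<pi> {1..n}"
    then have K: "?K \<in> hook_sets False \<pi> {1..n}" by blast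
    note D = hook_setsD[OF K, unfolded shift_hook_mem]
    have mem: "\<exists>i'. Suc i = Suc i' \<and> (i', e) \<in> set \<H>" if "(i, e) \<in> set \<H>" for i e using that by blast
    have hook: "is_hook n \<pi> (i, e)" if "(i, e) \<in> set \<H>" for i e
      using D(2-4)[OF mem[OF that]] unfolding ex by (auto simp: is_hook_def)
    have less: "i < e" if "(i, e) \<in> set \<H>" for i e using hook[OF that] by (simp add: is_hook_def)
    have ne: "\<exists>h'\<in>set \<H>. \<exists>h''\<in>set \<H>. sw h' \<in> descents n \<pi> \<and> sw h'' = e - 1 \<and> ne h' = e \<and> ne h'' = e"
      if ie: "(i, e) \<in> set \<H>" for i e
    proof -
      obtain i1 where "e = Suc i1" "(i1, e) \<in> set \<H>" using D(7)[OF mem[OF ie]] by blast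
      moreover obtain l i2 where "required False \<pi> {1..n} l" "l = Suc i2" "(i2, e) \<in> set \<H>"
        using D(8)[OF mem[OF ie]] by blast
      ultimately show ?thesis unfolding required_atLeastAtMost
        by (intro bexI[of _ "(i2, e)"] bexI[of _ "(i1, e)"]) auto
    qed
    have desc: "\<exists>h\<in>set \<H>. sw h = i" if i: "i \<in> descents n \<pi>" for i
    proof -
      have "required False \<pi> {1..n} (Suc i)" using i unfolding required_atLeastAtMost by blast
      then obtain e where "(i, e) \<in> set \<H>" using D(6) by blast
      then show ?thesis by (intro bexI[of _ "(i, e)"]) auto
    qed
    have nest: "span (i, e) \<subseteq> span (i', e')"
      if "(i, e) \<in> set \<H>" "(i', e') \<in> set \<H>" "\<pi> e < \<pi> e'"
        "\<exists>x y. x \<noteq> y \<and> x \<in> span (i, e) \<inter> span (i', e') \<and> y \<in> span (i, e) \<inter> span (i', e')" for i e i' e'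
    proof -
      have "i < e' \<and> i' < e"
        using that(4) span_overlap_iff[of "(i, e)" "(i', e')"] less[OF that(1)] less[OF that(2)] by simp
      then have "i' \<le> i \<and> e \<le> e'" using D(9)[OF mem[OF that(1)] mem[OF that(2)] that(3)] by simp
      then show ?thesis using less[OF that(1)] by (simp add: span_subset_iff)
    qed
    show "\<H> \<in> valid_hook_configs n \<pi>"
      unfolding valid_hook_configs_def mem_Collect_eq
    proof (intro conjI ballI impI)
      fix h assume h: "h \<in> set \<H>"
      show "is_hook n \<pi> h" using hook[of "sw h" "ne h"] h by simp
      show "\<exists>h'\<in>set \<H>. \<exists>h''\<in>set \<H>.
          sw h' \<in> descents n \<pi> \<and> sw h'' = ne h - 1 \<and> ne h' = ne h \<and> ne h'' = ne h"
        using ne[of "sw h" "ne h"] h by simp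
      fix h' assume h': "h' \<in> set \<H>"
        and o: "\<pi> (ne h) < \<pi> (ne h') \<and> (\<exists>x y. x \<noteq> y \<and> x \<in> span h \<inter> span h' \<and> y \<in> span h \<inter> span h')"
      show "span h \<subseteq> span h'"
        using nest[of "sw h" "ne h" "sw h'" "ne h'"] h h' o unfolding prod.collapse by blast
    qed (use a desc in auto)
  qed
qed

lemma ex1_sorted_by_fst:
  fixes S :: "(nat \<times> nat) set"
  assumes "finite S" "inj_on fst S"
  shows "\<exists>!xs. set xs = S \<and> sorted_wrt (<) (map fst xs)"
proof (rule ex_ex1I)
  let ?f = "inv_into S fst"
  let ?xs = "map ?f (sorted_list_of_set (fst ` S))"
  have "set ?xs = S" using assms by (simp add: image_image inv_into_f_f)
  moreover have "map fst ?xs = sorted_list_of_set (fst ` S)"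
    using assms by (auto simp: f_inv_into_f intro!: map_idI)
  ultimately show "\<exists>xs. set xs = S \<and> sorted_wrt (<) (map fst xs)"
    using strict_sorted_list_of_set by metis
next
  fix xs ys :: "(nat \<times> nat) list"
  assume xs: "set xs = S \<and> sorted_wrt (<) (map fst xs)" and ys: "set ys = S \<and> sorted_wrt (<) (map fst ys)"
  then have "set (map fst xs) = set (map fst ys)" by simp
  then have "map fst xs = map fst ys" using xs ys by (intro strict_sorted_equal) blast+
  then show "xs = ys" using xs ys assms(2) map_inj_on[of fst xs ys] by simp
qed

lemma bij_betw_valid_hook_configs:
  "bij_betw (\<lambda>\<H>. shift_hook ` set \<H>) (valid_hook_configs n \<pi>) (hook_sets False \<pi> {1..n})"
proof (intro bij_betw_imageI equalityI subsetI)
  show "inj_on (\<lambda>\<H>. shift_hook ` set \<H>) (valid_hook_configs n \<pi>)"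
  proof (rule inj_onI)
    fix xs ys assume xs: "xs \<in> valid_hook_configs n \<pi>" and ys: "ys \<in> valid_hook_configs n \<pi>"
      and "shift_hook ` set xs = shift_hook ` set ys"
    moreover have "inj shift_hook" by (auto simp: inj_on_def)
    ultimately have eq: "set xs = set ys" by (simp add: inj_image_eq_iff)
    have "distinct (map fst xs)" using xs by (auto simp: valid_hook_configs_iff strict_sorted_iff)
    then have "inj_on fst (set xs)" by (simp add: distinct_map)
    then show "xs = ys"
      using ex1_sorted_by_fst[of "set xs"] xs ys eq unfolding valid_hook_configs_iff by auto
  qed
next
  fix K assume "K \<in> (\<lambda>\<H>. shift_hook ` set \<H>) ` valid_hook_configs n \<pi>"
  then show "K \<in> hook_sets False \<pi> {1..n}" by (auto simp: valid_hook_configs_iff)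
next
  fix K assume K: "K \<in> hook_sets False \<pi> {1..n}"
  note D = hook_setsD[OF K]
  let ?S = "(\<lambda>(l, e). (l - 1, e)) ` K"
  have pos: "1 \<le> l" if "(l, e) \<in> K" for l e using D(1)[OF that] by simp
  have "shift_hook (case z of (l, e) \<Rightarrow> (l - 1, e)) = z" if "z \<in> K" for z
    using pos[of "fst z" "snd z"] that by (cases z) simp
  then have S: "shift_hook ` ?S = K" by (simp add: image_image)
  have "inj_on fst ?S"
  proof (rule inj_onI)
    fix a b assume "a \<in> ?S" "b \<in> ?S" and eq: "fst a = fst b"
    then obtain l e l' e' where ab: "a = (l - 1, e)" "(l, e) \<in> K" "b = (l' - 1, e')" "(l', e') \<in> K"
      by (auto elim!: imageE)
    then have "l = l'" using eq pos[OF ab(2)] pos[OF ab(4)] by simp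
    then show "a = b" using ab D(5) by blast
  qed
  moreover have "finite ?S" using finite_hook_set[OF _ K] by simp
  ultimately obtain xs where "set xs = ?S" "sorted_wrt (<) (map fst xs)"
    using ex1_sorted_by_fst by metis
  then show "K \<in> (\<lambda>\<H>. shift_hook ` set \<H>) ` valid_hook_configs n \<pi>"
    using S K by (intro image_eqI[of _ _ xs]) (auto simp: valid_hook_configs_iff)
qed

section \<open>Colors as first hits\<close>

lemma nth_hook_image: "set \<H> = nth_hook \<H> ` {1..length \<H>}"
proof -
  have "nth_hook \<H> ` Suc ` {..<length \<H>} = set \<H>"
    by (auto simp: nth_hook_def set_conv_nth image_image)
  then show ?thesis by (simp add: image_Suc_lessThan)
qed

context
  fixes n :: nat and \<pi> :: "nat \<Rightarrow> nat" and \<H> :: "hook list"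
  assumes valid: "\<H> \<in> valid_hook_configs n \<pi>" and inj: "inj_on \<pi> {1..n}"
begin

lemma sw_nth_hook_less:
  assumes "r \<in> {1..length \<H>}" "r' \<in> {1..length \<H>}" "r < r'"
  shows "sw (nth_hook \<H> r) < sw (nth_hook \<H> r')"
proof -
  have "sorted_wrt (<) (map sw \<H>)" using valid by (simp add: valid_hook_configs_def)
  from sorted_wrt_nth_less[OF this, of "r - 1" "r' - 1"] show ?thesis using assms by (simp add: nth_hook_def)
qed

text \<open>The largest index among hooks with a common endpoint thus belongs to the rightmost
  southwest endpoint, so one tie-break serves both cases of the coloring.\<close>

lemma sw_nth_hook_le_iff:
  assumes "r \<in> {1..length \<H>}" "r' \<in> {1..length \<H>}"
  shows "sw (nth_hook \<H> r) \<le> sw (nth_hook \<H> r') \<longleftrightarrow> r \<le> r'"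
  using sw_nth_hook_less[OF assms] sw_nth_hook_less[OF assms(2,1)] by (metis le_less not_le nat_neq_iff)

lemma hooks: "h \<in> set \<H> \<Longrightarrow> is_hook n \<pi> h"
  using valid by (simp add: valid_hook_configs_def)

lemma inj_nth_hook: "inj_on (\<lambda>r. shift_hook (nth_hook \<H> r)) {1..length \<H>}"
proof (rule inj_onI)
  fix r r' assume "r \<in> {1..length \<H>}" "r' \<in> {1..length \<H>}" "shift_hook (nth_hook \<H> r) = shift_hook (nth_hook \<H> r')"
  then show "r = r'" using sw_nth_hook_le_iff[of r r'] sw_nth_hook_le_iff[of r' r] by simp
qed

lemma card_lefts: "card {l. (l, j) \<in> shift_hook ` set \<H>} = ne_count \<H> j"
proof -
  let ?A = "{r\<in>{1..length \<H>}. ne (nth_hook \<H> r) = j}"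
  have "{l. (l, j) \<in> shift_hook ` set \<H>} = (\<lambda>r. Suc (sw (nth_hook \<H> r))) ` ?A"
    unfolding nth_hook_image[of \<H>] by force
  moreover have "inj_on (\<lambda>r. Suc (sw (nth_hook \<H> r))) ?A"
    using inj_nth_hook by (auto simp: inj_on_def)
  ultimately show ?thesis by (simp add: card_image ne_count_def)
qed

lemma hit_shift:
  "hit \<pi> (shift_hook ` set \<H>) x (shift_hook h) \<longleftrightarrow> h \<in> set \<H> \<and> sw h < x \<and> x \<le> ne h \<and> \<pi> x \<le> \<pi> (ne h)"
proof -
  have "shift_hook h \<in> shift_hook ` set \<H> \<longleftrightarrow> h \<in> set \<H>"
    by (cases h) (auto simp: shift_hook_mem)
  then show ?thesis by (auto simp: hit_def)
qed

lemma hit_cases: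
  assumes "hit \<pi> (shift_hook ` set \<H>) x z"
  obtains r where "r \<in> {1..length \<H>}" "z = shift_hook (nth_hook \<H> r)"
  using assms unfolding hit_def nth_hook_image[of \<H>] by auto

text \<open>Among the lowest hits the largest left end is chosen; by injectivity of \<pi> all lowest
  hits share their northeast endpoint.\<close>

lemma first_hit_exists:
  assumes "hit \<pi> (shift_hook ` set \<H>) x z"
  obtains r where "r \<in> {1..length \<H>}" "first_hit \<pi> (shift_hook ` set \<H>) x (shift_hook (nth_hook \<H> r))"
proof -
  let ?hit = "hit \<pi> (shift_hook ` set \<H>) x"
  obtain z1 where z1: "?hit z1" "\<And>z. ?hit z \<Longrightarrow> \<pi> (snd z1) \<le> \<pi> (snd z)"
    using ex_has_least_nat[of ?hit z "\<lambda>z. \<pi> (snd z)"] assms by blast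
  let ?A = "{l. ?hit (l, snd z1)}"
  have "?A \<subseteq> {..x}" by (auto simp: hit_def)
  then have A: "finite ?A" "?A \<noteq> {}" using z1(1) finite_subset[of ?A "{..x}"] by (auto intro: exI[of _ "fst z1"])
  have m: "?hit (Max ?A, snd z1)" using Max_in[OF A] by simp
  have "first_hit \<pi> (shift_hook ` set \<H>) x (Max ?A, snd z1)"
    unfolding first_hit_def
  proof (intro conjI allI impI)
    fix z assume z: "?hit z"
    have P: "snd z \<in> {1..n}" if "?hit z" for z
      using that hooks by (auto simp: hit_def is_hook_def)
    show "\<pi> (snd (Max ?A, snd z1)) < \<pi> (snd z) \<or>
        snd (Max ?A, snd z1) = snd z \<and> fst z \<le> fst (Max ?A, snd z1)"
    proof (cases "\<pi> (snd z1) < \<pi> (snd z)")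
      case False
      then have eq: "snd z1 = snd z"
        using z1(2)[OF z] inj_onD[OF inj _ P[OF z1(1)] P[OF z]] by simp
      then have "fst z \<in> ?A" using z by simp
      then show ?thesis using Max_ge[OF A(1)] eq by simp
    qed simp
  qed (rule m)
  moreover obtain r where "r \<in> {1..length \<H>}" "(Max ?A, snd z1) = shift_hook (nth_hook \<H> r)"
    by (rule hit_cases[OF m])
  ultimately show ?thesis using that by simp
qed

text \<open>The offset 1/2 excludes \<open>sw h\<close> and admits \<open>Suc (sw h)\<close>, so a
  top part lies over exactly the positions of the encoded hook.\<close>

lemma top_part_iff: "(real x, y) \<in> top_part \<pi> h \<longleftrightarrow> sw h < x \<and> x \<le> ne h \<and> y = real (\<pi> (ne h))"
  by (auto simp: top_part_def)

lemma color_no_hit: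
  assumes "\<And>z. \<not> hit \<pi> (shift_hook ` set \<H>) x z"
  shows "color \<pi> \<H> x = 0"
proof -
  have nh: "\<not> (sw h < x \<and> x \<le> ne h \<and> \<pi> x \<le> \<pi> (ne h))" if "h \<in> set \<H>" for h
    using assms[of "shift_hook h"] that unfolding hit_shift by blast
  have "ne h \<noteq> x" if "h \<in> set \<H>" for h
    using nh[OF that] hooks[OF that] by (auto simp: is_hook_def)
  moreover have "hit_heights \<pi> \<H> x = {}"
    using nh by (fastforce simp: hit_heights_def top_part_iff)
  ultimately show ?thesis by (auto simp: color_def)
qed

text \<open>A northeast endpoint is hit by its own hooks at its own height, the lowest possible, so
  its first hit is the rightmost of them. At other points injectivity makes the inequality in
  \<open>hit\<close> strict, as in \<open>hit_heights\<close>.\<close>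

lemma color_first_hit:
  assumes x: "x \<in> {1..n}" and r: "r \<in> {1..length \<H>}"
    and fh: "first_hit \<pi> (shift_hook ` set \<H>) x (shift_hook (nth_hook \<H> r))"
  shows "color \<pi> \<H> x = r"
proof -
  let ?h = "nth_hook \<H> r"
  have h: "?h \<in> set \<H>" "sw ?h < x" "x \<le> ne ?h" "\<pi> x \<le> \<pi> (ne ?h)"
    using fh hit_shift[of x ?h] by (auto simp: first_hit_def)
  have min: "\<pi> (ne ?h) < \<pi> (ne h') \<or> ne ?h = ne h' \<and> sw h' \<le> sw ?h"
    if "h' \<in> set \<H>" "sw h' < x" "x \<le> ne h'" "\<pi> x \<le> \<pi> (ne h')" for h'
  proof -
    have "hit \<pi> (shift_hook ` set \<H>) x (shift_hook h')" using that hit_shift by blast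
    then show ?thesis using fh unfolding first_hit_def by fastforce
  qed
  have nth: "nth_hook \<H> s \<in> set \<H>" if "s \<in> {1..length \<H>}" for s
    using that nth_hook_image[of \<H>] by blast
  show ?thesis
  proof (cases "ne ?h = x")
    case True
    have "Max {s\<in>{1..length \<H>}. ne (nth_hook \<H> s) = x} = r"
    proof (rule Max_eqI)
      fix s assume s: "s \<in> {s\<in>{1..length \<H>}. ne (nth_hook \<H> s) = x}"
      then have "sw (nth_hook \<H> s) < x" using hooks[OF nth[of s]] by (auto simp: is_hook_def)
      then have "sw (nth_hook \<H> s) \<le> sw ?h" using min[OF nth[of s]] s True by auto
      then show "s \<le> r" using sw_nth_hook_le_iff[of s r] s r by simp
    qed (use r True in auto)
    moreover have "\<exists>h\<in>set \<H>. ne h = x" using True h(1) by blast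
    ultimately show ?thesis unfolding color_def by simp
  next
    case False
    \<comment> \<open>A hook ending at \<open>x\<close> is a hit at height \<pi> x, so the first hit
      would have to end at \<open>x\<close> too.\<close>
    have no_ne: "\<not> (\<exists>h'\<in>set \<H>. ne h' = x)"
    proof
      assume "\<exists>h'\<in>set \<H>. ne h' = x"
      then obtain h' where h': "h' \<in> set \<H>" "ne h' = x" by blast
      then have "sw h' < x" using hooks by (auto simp: is_hook_def)
      then show False using min[OF h'(1)] h' h(4) False by auto
    qed
    have P: "ne h' \<in> {1..n}" if "h' \<in> set \<H>" for h' using hooks[OF that] by (simp add: is_hook_def)
    have "\<pi> x < \<pi> (ne ?h)" using h(4) False inj_onD[OF inj _ x P[OF h(1)]] by (auto simp: le_less)
    then have mem: "real (\<pi> (ne ?h)) \<in> hit_heights \<pi> \<H> x"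
      using h by (auto simp: hit_heights_def top_part_iff)
    have Min: "Min (hit_heights \<pi> \<H> x) = real (\<pi> (ne ?h))"
    proof (rule Min_eqI)
      have "hit_heights \<pi> \<H> x \<subseteq> (\<lambda>h. real (\<pi> (ne h))) ` set \<H>"
        by (auto simp: hit_heights_def top_part_iff)
      then show "finite (hit_heights \<pi> \<H> x)" using finite_surj by blast
      fix y assume "y \<in> hit_heights \<pi> \<H> x"
      then obtain h' where h': "h' \<in> set \<H>" "sw h' < x" "x \<le> ne h'" "y = real (\<pi> (ne h'))" "real (\<pi> x) < y"
        by (auto simp: hit_heights_def top_part_iff)
      then show "real (\<pi> (ne ?h)) \<le> y" using min[OF h'(1-3)] by auto
    qed (rule mem)
    let ?P = "\<lambda>l. l \<in> {1..length \<H>} \<and> (real x, Min (hit_heights \<pi> \<H> x)) \<in> top_part \<pi> (nth_hook \<H> l)"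
    have P_le: "sw (nth_hook \<H> l) \<le> sw ?h" if "?P l" for l
    proof -
      have l: "nth_hook \<H> l \<in> set \<H>" "sw (nth_hook \<H> l) < x" "x \<le> ne (nth_hook \<H> l)"
        "\<pi> (ne (nth_hook \<H> l)) = \<pi> (ne ?h)"
        using that nth[of l] unfolding top_part_iff Min by auto
      from l(4) have "\<pi> x \<le> \<pi> (ne (nth_hook \<H> l))" using h(4) by simp
      from min[OF l(1-3) this] l(4) show ?thesis by (metis less_irrefl)
    qed
    have "?P r" using r h unfolding top_part_iff Min by simp
    \<comment> \<open>Distinct indices have distinct southwest endpoints, so the maximizer is unique
      and the choice in \<open>ARG_MAX\<close> is determined.\<close>
    then have "(ARG_MAX (\<lambda>l. sw (nth_hook \<H> l)) l. ?P l) = r"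
    proof (rule arg_maxI[where Q = "\<lambda>l. l = r"])
      fix l assume l: "?P l" "\<forall>s. ?P s \<longrightarrow> \<not> sw (nth_hook \<H> l) < sw (nth_hook \<H> s)"
      then have "sw ?h \<le> sw (nth_hook \<H> l)" using \<open>?P r\<close> by (auto simp: not_less)
      then show "l = r" using P_le[OF l(1)] sw_nth_hook_le_iff[of l r] sw_nth_hook_le_iff[of r l] l(1) r by auto
    qed (use P_le in \<open>auto simp: not_less\<close>)
    then show ?thesis unfolding color_def using no_ne mem by auto
  qed
qed

lemma color_count_0:
  "color_count n \<pi> \<H> 0 = card {x\<in>{1..n}. \<forall>z. \<not> hit \<pi> (shift_hook ` set \<H>) x z}"
proof -
  have *: "color \<pi> \<H> x = 0 \<longleftrightarrow> (\<forall>z. \<not> hit \<pi> (shift_hook ` set \<H>) x z)" if x: "x \<in> {1..n}" for x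
  proof
    assume "color \<pi> \<H> x = 0"
    then have no: "r \<notin> {1..length \<H>}"
      if "first_hit \<pi> (shift_hook ` set \<H>) x (shift_hook (nth_hook \<H> r))" for r
      using color_first_hit[OF x _ that] by auto
    show "\<forall>z. \<not> hit \<pi> (shift_hook ` set \<H>) x z"
    proof (intro allI notI)
      fix z assume z: "hit \<pi> (shift_hook ` set \<H>) x z"
      obtain r where "r \<in> {1..length \<H>}" "first_hit \<pi> (shift_hook ` set \<H>) x (shift_hook (nth_hook \<H> r))"
        by (rule first_hit_exists[OF z])
      then show False using no by blast
    qed
  qed (use color_no_hit in blast)
  show ?thesis unfolding color_count_def by (intro arg_cong[where f = card] Collect_cong) (use * in blast)
qed

lemma color_count_pos:
  assumes r: "r \<in> {1..length \<H>}"
  shows "color_count n \<pi> \<H> r = card {x\<in>{1..n}. first_hit \<pi> (shift_hook ` set \<H>) x (shift_hook (nth_hook \<H> r))}"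
proof -
  have *: "color \<pi> \<H> x = r \<longleftrightarrow> first_hit \<pi> (shift_hook ` set \<H>) x (shift_hook (nth_hook \<H> r))"
    if x: "x \<in> {1..n}" for x
  proof
    assume c: "color \<pi> \<H> x = r"
    have "\<exists>z. hit \<pi> (shift_hook ` set \<H>) x z"
    proof (rule ccontr)
      assume "\<nexists>z. hit \<pi> (shift_hook ` set \<H>) x z"
      then have "color \<pi> \<H> x = 0" using color_no_hit by blast
      then show False using c r by simp
    qed
    then obtain z where z: "hit \<pi> (shift_hook ` set \<H>) x z" by blast
    obtain s where "s \<in> {1..length \<H>}" "first_hit \<pi> (shift_hook ` set \<H>) x (shift_hook (nth_hook \<H> s))"
      by (rule first_hit_exists[OF z])
    then show "first_hit \<pi> (shift_hook ` set \<H>) x (shift_hook (nth_hook \<H> r))"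
      using color_first_hit[OF x] c by blast
  qed (rule color_first_hit[OF x r])
  show ?thesis unfolding color_count_def by (intro arg_cong[where f = card] Collect_cong) (use * in blast)
qed

lemma weight_shift:
  "weight E d \<pi> {1..n} (shift_hook ` set \<H>) =
    (\<Prod>j=1..n. d choose ne_count \<H> j) * (\<Prod>t=0..length \<H>. E (color_count n \<pi> \<H> t))"
proof -
  let ?K = "shift_hook ` set \<H>"
  have K: "?K = (\<lambda>r. shift_hook (nth_hook \<H> r)) ` {1..length \<H>}"
    unfolding nth_hook_image[of \<H>] by (simp add: image_image)
  have "(\<Prod>z\<in>?K. E (card {x\<in>{1..n}. first_hit \<pi> ?K x z})) =
      (\<Prod>z\<in>(\<lambda>r. shift_hook (nth_hook \<H> r)) ` {1..length \<H>}. E (card {x\<in>{1..n}. first_hit \<pi> ?K x z}))"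
    using K by simp
  also have "\<dots> = (\<Prod>r=1..length \<H>. E (color_count n \<pi> \<H> r))"
    using inj_nth_hook by (subst prod.reindex) (auto simp: color_count_pos)
  finally have "(\<Prod>z\<in>?K. E (card {x\<in>{1..n}. first_hit \<pi> ?K x z})) = (\<Prod>r=1..length \<H>. E (color_count n \<pi> \<H> r))" .
  moreover have "(\<Prod>t=0..length \<H>. E (color_count n \<pi> \<H> t)) =
      E (color_count n \<pi> \<H> 0) * (\<Prod>r=1..length \<H>. E (color_count n \<pi> \<H> r))"
    by (simp add: prod.atLeast_Suc_atMost)
  ultimately show ?thesis unfolding weight_def by (simp add: card_lefts color_count_0)
qed

end

theorem theorem4p2:
  fixes n d :: nat and \<pi> :: "nat \<Rightarrow> nat"
  assumes "n \<ge> 1" and "\<pi> permutes {1..n}" and "d \<ge> 1"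
  shows "card {t \<in> decreasing_dary_trees d {1..n}. postorder t = word n \<pi>} =
    (\<Sum>\<H> \<in> valid_hook_configs_in ({1..d} \<union> {0}) n \<pi>.
       (\<Prod>j=1..n. d choose ne_count \<H> j) *
       (\<Prod>t=0..length \<H>. num_dary_trees d (color_count n \<pi> \<H> t)))"
    (is "_ = sum ?w _")
proof -
  have inj: "inj_on \<pi> {1..n}" using assms(2) permutes_inj_on by blast
  have word: "map \<pi> (sorted_list_of_set {1..n}) = word n \<pi>"
    unfolding word_def by (metis atLeastLessThanSuc_atLeastAtMost sorted_list_of_set_range)
  \<comment> \<open>The postorder has one entry per vertex, so the word fixes both the labels and
    the number of vertices.\<close>
  have "set_ptree t = {1..n} \<and> num_vertices t = card {1..n}" if "postorder t = word n \<pi>" for t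
  proof -
    have "set (word n \<pi>) = {1..n}" "length (word n \<pi>) = n"
      unfolding word[symmetric] using permutes_image[OF assms(2)] by simp_all
    then show ?thesis using set_postorder[of t] length_postorder[of t] that by (metis card_atLeastAtMost diff_Suc_1)
  qed
  then have "{t \<in> decreasing_dary_trees d {1..n}. postorder t = word n \<pi>} = postorder_trees d \<pi> {1..n}"
    unfolding decreasing_dary_trees_def postorder_trees_def word by blast
  then have "card {t \<in> decreasing_dary_trees d {1..n}. postorder t = word n \<pi>} =
      hook_total False (num_dary_trees d) d \<pi> {1..n}"
    using card_postorder_trees_eq_hook_total[OF _ inj] by simp
  also have "\<dots> = (\<Sum>\<H>\<in>valid_hook_configs n \<pi>. weight (num_dary_trees d) d \<pi> {1..n} (shift_hook ` set \<H>))"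
    unfolding hook_total_def by (rule sum.reindex_bij_betw[OF bij_betw_valid_hook_configs, symmetric])
  also have "\<dots> = sum ?w (valid_hook_configs n \<pi>)"
    by (intro sum.cong refl weight_shift inj)
  \<comment> \<open>If more than \<open>d\<close> hooks share an endpoint, the binomial there is 0,
    so the restriction to \<open>{1..d} \<union> {0}\<close> drops only zero terms.\<close>
  also have "\<dots> = sum ?w (valid_hook_configs_in ({1..d} \<union> {0}) n \<pi>)"
  proof (rule sum.mono_neutral_right)
    show "finite (valid_hook_configs n \<pi>)"
      using bij_betw_finite[OF bij_betw_valid_hook_configs] finite_hook_sets by blast
    show "\<forall>\<H>\<in>valid_hook_configs n \<pi> - valid_hook_configs_in ({1..d} \<union> {0}) n \<pi>. ?w \<H> = 0"
    proof
      fix \<H> assume "\<H> \<in> valid_hook_configs n \<pi> - valid_hook_configs_in ({1..d} \<union> {0}) n \<pi>"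
      then obtain j where j: "j \<in> {1..n}" "ne_count \<H> j \<notin> {1..d} \<union> {0}"
        by (auto simp: valid_hook_configs_in_def)
      then have "d choose ne_count \<H> j = 0" by (intro binomial_eq_0) auto
      then have "(\<Prod>j=1..n. d choose ne_count \<H> j) = 0" using j(1) by (intro prod_zero) auto
      then show "?w \<H> = 0" by simp
    qed
  qed (auto simp: valid_hook_configs_in_def)
  finally show ?thesis .
qed

end
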